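(* Let $b_1,b_2,b_3,c_1$ be real with $c_1>b_1>0$, let $x,y$ be real with $x<1$, $y<1$, let $\nu\ge0$ be real, and let $p\in\mathbb{C}$ with $\Re(p)>0$. Then $$|F_{1,p,\nu}(b_1,b_2,b_3;c_1;x,y)|<\frac{2^\nu|p|^{\nu+1}}{\sqrt{\pi}\,(\Re(p))^{2\nu+1}}\,\frac{\Gamma(\nu+\frac12)\,B(b_1+\nu,\,c_1-b_1+\nu)}{B(b_1,\,c_1-b_1)}\,F_1(b_1+\nu,b_2,b_3;c_1+2\nu;x,y).$$
   Context: $K_\alpha$ is the modified Bessel function of the second kind of order $\alpha$; powers and square roots take principal values. $(\lambda)_n$ is the Pochhammer symbol $\lambda(\lambda+1)\cdots(\lambda+n-1)$, $(\lambda)_0=1$, and $B(\alpha,\beta)=\Gamma(\alpha)\Gamma(\beta)/\Gamma(\alpha+\beta)$. For $\Re(p)>0$, $\nu\ge0$, $$B_{p,\nu}(u,v)=\sqrt{\frac{2p}{\pi}}\int_0^1 t^{u-\frac32}(1-t)^{v-\frac32}K_{\nu+\frac12}\!\left(\frac{p}{t(1-t)}\right)dt .$$ The extended Appell function is defined for $|x|<1$, $|y|<1$ by $$F_{1,p,\nu}(b_1,b_2,b_3;c_1;x,y)=\sum_{m,n=0}^\infty\frac{(b_2)_m(b_3)_n\,B_{p,\nu}(b_1+m+n,c_1-b_1)}{B(b_1,c_1-b_1)}\frac{x^m}{m!}\frac{y^n}{n!},$$ and for $|\arg(1-x)|<\pi$, $|\arg(1-y)|<\pi$, $\Re(c_1)>\Re(b_1)>0$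 by its analytic continuation $$\frac{\Gamma(c_1)}{\Gamma(b_1)\Gamma(c_1-b_1)}\sqrt{\frac{2p}{\pi}}\int_0^1 t^{b_1-\frac32}(1-t)^{c_1-b_1-\frac32}(1-xt)^{-b_2}(1-yt)^{-b_3}K_{\nu+\frac12}\!\left(\frac{p}{t(1-t)}\right)dt.$$ The classical Appell function $F_1$ is, for $\Re(c)>\Re(a)>0$ and $|\arg(1-x)|<\pi$, $|\arg(1-y)|<\pi$, $$F_1(a,b_2,b_3;c;x,y)=\frac{\Gamma(c)}{\Gamma(a)\Gamma(c-a)}\int_0^1t^{a-1}(1-t)^{c-a-1}(1-xt)^{-b_2}(1-yt)^{-b_3}dt.$$ *)

theory Defs
  imports "HOL-Analysis.Analysis"
begin

text \<open>
  Modified Bessel functions of real order. Writing the coefficient of the power series with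
  \<^const>\<open>rGamma\<close> makes it vanish at the poles of the Gamma function.
\<close>

definition bessel_I :: "real \<Rightarrow> complex \<Rightarrow> complex" where
  "bessel_I a z =
     (z / 2) powr of_real a *
     (\<Sum>k. rGamma (of_real a + of_nat k + 1) / fact k * (z\<^sup>2 / 4) ^ k)"

text \<open>
  At integer order the defining quotient is \<open>0 / 0\<close>; the function is then its limit in the order.
\<close>

definition bessel_K :: "real \<Rightarrow> complex \<Rightarrow> complex" where
  "bessel_K a z =
     (let q = (\<lambda>b. of_real pi / 2 * (bessel_I (- b) z - bessel_I b z) / of_real (sin (b * pi)))
      in if a \<in> \<int> then Lim (at a) q else q a)"

definition ext_Beta :: "complex \<Rightarrow> real \<Rightarrow> complex \<Rightarrow> complex \<Rightarrow> complex" where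
  "ext_Beta p \<nu> u v =
     csqrt (2 * p / of_real pi) *
     (LINT t:{0<..<1}|lborel.
        of_real t powr (u - 3 / 2) * of_real (1 - t) powr (v - 3 / 2) *
        bessel_K (\<nu> + 1 / 2) (p / of_real (t * (1 - t))))"

text \<open>
  The double series and the Euler-type integral which continues it analytically. The series is
  meant for \<open>|x| < 1\<close>, \<open>|y| < 1\<close>; the integral for \<open>Re c1 > Re b1 > 0\<close> and \<open>x\<close>, \<open>y\<close> off the
  ray \<open>[1,\<infinity>)\<close>, where \<open>1 - x t\<close> and \<open>1 - y t\<close> avoid the cut of \<^const>\<open>powr\<close>.
\<close>

definition ext_appell_F1_series ::
    "complex \<Rightarrow> real \<Rightarrow> complex \<Rightarrow> complex \<Rightarrow> complex \<Rightarrow> complex \<Rightarrow> complex \<Rightarrow> complex \<Rightarrow> complex" where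
  "ext_appell_F1_series p \<nu> b1 b2 b3 c1 x y =
     (\<Sum>\<^sub>\<infinity>(m, n)\<in>UNIV.
        pochhammer b2 m * pochhammer b3 n *
        ext_Beta p \<nu> (b1 + of_nat m + of_nat n) (c1 - b1) / Beta b1 (c1 - b1) *
        (x ^ m / fact m) * (y ^ n / fact n))"

definition ext_appell_F1_integral ::
    "complex \<Rightarrow> real \<Rightarrow> complex \<Rightarrow> complex \<Rightarrow> complex \<Rightarrow> complex \<Rightarrow> complex \<Rightarrow> complex \<Rightarrow> complex" where
  "ext_appell_F1_integral p \<nu> b1 b2 b3 c1 x y =
     Gamma c1 / (Gamma b1 * Gamma (c1 - b1)) * csqrt (2 * p / of_real pi) *
     (LINT t:{0<..<1}|lborel.
        of_real t powr (b1 - 3 / 2) * of_real (1 - t) powr (c1 - b1 - 3 / 2) *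
        (1 - x * of_real t) powr (- b2) * (1 - y * of_real t) powr (- b3) *
        bessel_K (\<nu> + 1 / 2) (p / of_real (t * (1 - t))))"

definition ext_appell_F1 ::
    "complex \<Rightarrow> real \<Rightarrow> complex \<Rightarrow> complex \<Rightarrow> complex \<Rightarrow> complex \<Rightarrow> complex \<Rightarrow> complex \<Rightarrow> complex" where
  "ext_appell_F1 p \<nu> b1 b2 b3 c1 x y =
     (if norm x < 1 \<and> norm y < 1 then ext_appell_F1_series p \<nu> b1 b2 b3 c1 x y
      else ext_appell_F1_integral p \<nu> b1 b2 b3 c1 x y)"

text \<open>
  The classical function is stated for real and complex arguments alike, so that it is real-valued
  at real arguments. For real arguments the bases below are positive when \<open>x < 1\<close>, \<open>y < 1\<close>.
\<close>

definition appell_F1 ::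
    "'a \<Rightarrow> 'a \<Rightarrow> 'a \<Rightarrow> 'a \<Rightarrow> 'a \<Rightarrow> 'a \<Rightarrow> 'a::{Gamma, ln, banach, second_countable_topology}" where
  "appell_F1 a b2 b3 c x y =
     Gamma c / (Gamma a * Gamma (c - a)) *
     (LINT t:{0<..<1}|lborel.
        of_real t powr (a - 1) * of_real (1 - t) powr (c - a - 1) *
        (1 - x * of_real t) powr (- b2) * (1 - y * of_real t) powr (- b3))"

end

theory Submission
  imports Defs "HOL-Real_Asymp.Real_Asymp"
begin

text \<open>
  For \<open>Re z > 0\<close> the Bessel function \<open>K\<^sub>a(z)\<close> is half the integral of \<open>exp (a t - z cosh t)\<close> over the
  real line. Bounding \<open>cosh t\<close> from below by \<open>exp t / 2\<close> turns this into a Gamma integral and gives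
  \<open>\<bar>K\<^sub>a(z)\<bar> < \<Gamma>(a) (2 / Re z)\<^sup>a / 2\<close>. Inserted into the Euler integral with \<open>z = p / (t (1 - t))\<close> and
  \<open>a = \<nu> + 1/2\<close>, it leaves the integral of the classical function with both Beta exponents shifted
  by \<open>\<nu>\<close>.

  The integral representation is derived from the power series without appeal to uniqueness for
  Bessel's equation: the pairs \<open>(J\<^sub>a, J\<^sub>a\<^sub>-\<^sub>1)\<close> of integrals and \<open>(I\<^sub>-\<^sub>a, - I\<^sub>1\<^sub>-\<^sub>a)\<close> of series satisfy the same
  first order system, so their Wronskians with \<open>(I\<^sub>a, I\<^sub>a\<^sub>-\<^sub>1)\<close> are constant, and the constants are
  limits at 0. For \<open>0 < a < 1\<close> this determines \<open>J\<^sub>a\<close> algebraically; recurrences reach all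
  non-integer orders and continuity in the order the integer ones.
\<close>

subsection \<open>Gamma integrals and parameter integrals\<close>

text \<open>The substitution \<open>s = exp t\<close> in Euler's integral for
  \<open>Gamma a\<close>. With the whole real line as domain, later translations of \<open>t\<close>
  leave the range unchanged.\<close>

lemma has_bochner_integral_Gamma_exp:
  assumes a: "(a::real) > 0"
  shows "has_bochner_integral lborel (\<lambda>t. exp (a * t - exp t)) (Gamma a)"
proof -
  define f where "f = (\<lambda>t. t powr (a - 1) / exp t)"
  have "(f has_integral Gamma a) {0<..}"
    using Gamma_integral_real[OF a] unfolding f_def
    by (rule has_integral_spike_set_eq [THEN iffD1, rotated -1])
       (auto intro: negligible_subset[of "{0}"])
  then have "f absolutely_integrable_on {0<..} \<and> integral {0<..} f = Gamma a"
    by (intro conjI nonnegative_absolutely_integrable_1) (auto simp: f_def integral_unique)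
  moreover have "range (exp :: real \<Rightarrow> real) = {0<..}"
    by (auto intro: rangeI[of exp "ln _"] simp: image_iff) (metis exp_ln)
  ultimately have "(\<lambda>t. \<bar>exp t\<bar> *\<^sub>R f (exp t)) absolutely_integrable_on UNIV
      \<and> integral UNIV (\<lambda>t. \<bar>exp t\<bar> *\<^sub>R f (exp t)) = Gamma a"
    using has_absolute_integral_change_of_variables_1'[of UNIV exp exp f "Gamma a"]
    by (auto intro: DERIV_subset[OF DERIV_exp] simp: inj_on_def)
  moreover have "\<bar>exp t\<bar> *\<^sub>R f (exp t) = exp (a * t - exp t)" for t
    by (simp add: f_def powr_def exp_diff left_diff_distrib)
  ultimately have *: "(\<lambda>t. exp (a * t - exp t)) absolutely_integrable_on UNIV"
      "integral UNIV (\<lambda>t. exp (a * t - exp t)) = Gamma a"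
    by simp_all
  \<comment> \<open>So far the integral is taken over the completed measure; Borel measurability of
    the integrand carries it back to \<open>lborel\<close>.\<close>
  have "integrable lborel (\<lambda>t. exp (a * t - exp t))"
    using *(1) by (subst integrable_completion [symmetric])
      (auto simp: set_integrable_def cong: measurable_cong_sets intro!: borel_measurable_continuous_onI continuous_intros)
  moreover from this have "integral\<^sup>L lborel (\<lambda>t. exp (a * t - exp t)) = Gamma a"
    using *(2) by (simp add: integral_lborel)
  ultimately show ?thesis by (simp add: has_bochner_integral_iff)
qed

text \<open>With \<open>s = |t|\<close> the integrand is at most
  \<open>exp (b * s - x/2 * exp s)\<close>, up to a factor a translate of the Gamma integrand. Since
  \<open>s\<close> is \<open>t\<close> or \<open>-t\<close>, the sum over both signs is an
  integrable majorant.\<close>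

lemma integrable_exp_cosh:
  assumes x: "(x::real) > 0"
  shows "integrable lborel (\<lambda>t. exp (a * t - x * cosh t))"
proof -
  \<comment> \<open>The maximum with 1 keeps the Gamma parameter positive when
    \<open>a = 0\<close>.\<close>
  define b where "b = max \<bar>a\<bar> 1"
  define h where "h = (\<lambda>t. exp (b * t - exp t))"
  have b: "b > 0" by (auto simp: b_def)
  have h: "integrable lborel h"
    using has_bochner_integral_Gamma_exp[OF b] by (auto simp: h_def has_bochner_integral_iff)
  \<comment> \<open>Translation by \<open>ln (x/2)\<close> turns \<open>exp s\<close> into
    \<open>x/2 * exp s\<close>; the prefactor undoes its effect on \<open>b * s\<close>.\<close>
  define k where "k = (\<lambda>t. exp (- b * ln (x/2)) * (h (ln (x/2) + 1 * t) + h (ln (x/2) + (-1) * t)))"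
  have k: "integrable lborel k"
    unfolding k_def
    by (intro integrable_mult_right Bochner_Integration.integrable_add lborel_integrable_real_affine h) auto
  have bd: "exp (a * t - x * cosh t) \<le> k t" for t
  proof -
    have 1: "exp (- b * ln (x/2)) * h (ln (x/2) + s) = exp (b * s - x/2 * exp s)" for s
    proof -
      have "exp (ln (x/2) + s) = x/2 * exp s" using x by (simp add: exp_add)
      then show ?thesis by (simp add: h_def algebra_simps flip: exp_add)
    qed
    have 2: "exp (a * t - x * cosh t) \<le> exp (b * s - x/2 * exp s)" if "s = \<bar>t\<bar>" for s
    proof -
      have "a * t \<le> b * s"
        using that by (metis abs_le_D1 abs_mult mult_right_mono abs_ge_zero b_def max.cobounded1)
      moreover have "x/2 * exp s \<le> x * cosh t"
      proof -
        have "exp s / 2 \<le> cosh t" using that by (auto simp: cosh_def abs_if)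
        from mult_left_mono[OF this, of x] x show ?thesis by simp
      qed
      ultimately show ?thesis by simp
    qed
    show ?thesis
    proof (cases "t \<ge> 0")
      case True
      have "k t = exp (b * t - x/2 * exp t) + exp (b * (-t) - x/2 * exp (-t))"
        unfolding k_def distrib_left using 1[of t] 1[of "-t"] by simp
      with 2[of t] True show ?thesis
        by (smt (verit) exp_gt_zero)
    next
      case False
      have "k t = exp (b * t - x/2 * exp t) + exp (b * (-t) - x/2 * exp (-t))"
        unfolding k_def distrib_left using 1[of t] 1[of "-t"] by simp
      with 2[of "-t"] False show ?thesis
        by (smt (verit) exp_gt_zero)
    qed
  qed
  show ?thesis
    by (rule Bochner_Integration.integrable_bound[OF k])
       (use bd in \<open>auto intro!: borel_measurable_continuous_onI continuous_intros order_trans[OF bd]\<close>)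
qed

text \<open>If the integrals agreed, the nonnegative difference would vanish almost everywhere,
  which is impossible on the non-null set \<open>A\<close>. This keeps inequalities strict under
  integration.\<close>

lemma integral_strict_mono:
  fixes f g :: "'a \<Rightarrow> real"
  assumes int: "integrable M f" "integrable M g"
    and le: "\<And>t. t \<in> space M \<Longrightarrow> f t \<le> g t"
    and A: "A \<in> sets M" "emeasure M A \<noteq> 0"
    and less: "\<And>t. t \<in> A \<Longrightarrow> f t < g t"
  shows "integral\<^sup>L M f < integral\<^sup>L M g"
proof -
  have "integral\<^sup>L M (\<lambda>t. g t - f t) \<noteq> 0"
  proof
    assume "integral\<^sup>L M (\<lambda>t. g t - f t) = 0"
    then have "AE t in M. g t - f t = 0"
      using int le by (subst (asm) integral_nonneg_eq_0_iff_AE) auto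
    then have "AE t in M. t \<notin> A"
      by eventually_elim (use less in force)
    with A show False
      by (simp add: AE_iff_measurable[OF A(1)] sets.sets_into_space Int_absorb1 flip: Int_def)
  qed
  moreover have "integral\<^sup>L M f \<le> integral\<^sup>L M g"
    using int le by (intro integral_mono) auto
  ultimately show ?thesis using int by simp
qed

text \<open>In a first countable space, limits within \<open>S\<close> are determined by sequences,
  so sequential dominated convergence suffices for a continuous parameter.\<close>

lemma integral_dominated_convergence_within:
  fixes f :: "'a::first_countable_topology \<Rightarrow> 'b \<Rightarrow> 'c::{banach, second_countable_topology}"
  assumes lim: "\<And>t. ((\<lambda>z. f z t) \<longlongrightarrow> g t) (at x within S)"
    and bound: "\<And>z t. z \<in> S - {x} \<Longrightarrow> norm (f z t) \<le> h t"
    and h: "integrable M h"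
    and meas: "\<And>z. z \<in> S - {x} \<Longrightarrow> f z \<in> borel_measurable M" "g \<in> borel_measurable M"
  shows "((\<lambda>z. integral\<^sup>L M (f z)) \<longlongrightarrow> integral\<^sup>L M g) (at x within S)"
  unfolding tendsto_at_iff_sequentially comp_def
proof (intro allI impI)
  fix X assume X: "\<forall>i. X i \<in> S - {x}" "X \<longlonglongrightarrow> x"
  show "(\<lambda>n. integral\<^sup>L M (f (X n))) \<longlonglongrightarrow> integral\<^sup>L M g"
  proof (rule integral_dominated_convergence[where w = h])
    show "AE t in M. (\<lambda>i. f (X i) t) \<longlonglongrightarrow> g t"
      using lim X unfolding tendsto_at_iff_sequentially comp_def by (intro AE_I2) blast
  qed (use X bound h meas in auto)
qed

text \<open>On the convex ball the mean value inequality bounds every difference quotient by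
  \<open>h t\<close>, so dominated convergence applies to the quotients.\<close>

lemma has_field_derivative_integral:
  fixes f f' :: "complex \<Rightarrow> 'b \<Rightarrow> complex"
  assumes r: "r > 0"
    and der: "\<And>w t. w \<in> ball z r \<Longrightarrow> ((\<lambda>w. f w t) has_field_derivative f' w t) (at w)"
    and bound: "\<And>w t. w \<in> ball z r \<Longrightarrow> norm (f' w t) \<le> h t"
    and h: "integrable M h"
    and int: "\<And>w. w \<in> ball z r \<Longrightarrow> integrable M (f w)"
    and meas: "f' z \<in> borel_measurable M"
  shows "((\<lambda>w. integral\<^sup>L M (f w)) has_field_derivative integral\<^sup>L M (f' z)) (at z)"
proof -
  have z: "z \<in> ball z r" using r by simp
  have "((\<lambda>w. LINT t|M. (f w t - f z t) / (w - z)) \<longlongrightarrow> integral\<^sup>L M (f' z)) (at z within ball z r)"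
  proof (rule integral_dominated_convergence_within[OF _ _ h])
    show "((\<lambda>w. (f w t - f z t) / (w - z)) \<longlongrightarrow> f' z t) (at z within ball z r)" for t
      using der[OF z, of t] unfolding has_field_derivative_iff by (rule tendsto_within_subset) simp
    show "norm ((f w t - f z t) / (w - z)) \<le> h t" if "w \<in> ball z r - {z}" for w t
    proof -
      have "norm (f w t - f z t) \<le> h t * norm (w - z)"
        by (rule field_differentiable_bound[where S = "ball z r" and f' = "\<lambda>w. f' w t"])
           (use that z bound der in \<open>auto intro: has_field_derivative_at_within\<close>)
      with that show ?thesis by (simp add: norm_divide pos_divide_le_eq)
    qed
    show "(\<lambda>t. (f w t - f z t) / (w - z)) \<in> borel_measurable M" if "w \<in> ball z r - {z}" for w
      using that int[of w] int[OF z] by (intro borel_measurable_divide borel_measurable_diff) auto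
  qed (use meas in auto)
  moreover have "\<forall>\<^sub>F w in at z within ball z r.
      (LINT t|M. (f w t - f z t) / (w - z)) = (integral\<^sup>L M (f w) - integral\<^sup>L M (f z)) / (w - z)"
    unfolding eventually_at_filter using int z by (auto intro!: always_eventually)
  ultimately have "((\<lambda>w. (integral\<^sup>L M (f w) - integral\<^sup>L M (f z)) / (w - z)) \<longlongrightarrow> integral\<^sup>L M (f' z))
      (at z within ball z r)"
    by (rule Lim_transform_eventually)
  then show ?thesis
    unfolding has_field_derivative_iff at_within_open[OF z open_ball] .
qed

subsection \<open>The integral of exp (a t - z cosh t)\<close>

text \<open>For \<open>Re z > 0\<close> this is twice the classical integral of
  \<open>exp (- z cosh t) cosh (a t)\<close> over the positive half-line. Keeping a single
  exponential makes a change of order a multiplication by a power of \<open>exp t\<close>.\<close>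

definition cosh_integral :: "real \<Rightarrow> complex \<Rightarrow> complex" where
  "cosh_integral a z = (LINT t|lborel. exp (of_real (a * t) - z * of_real (cosh t)))"

lemma norm_exp_cosh:
  "norm (exp (of_real (a * t) - z * of_real (cosh t)) :: complex) = exp (a * t - Re z * cosh t)"
  by (simp add: norm_exp_eq_Re)

lemma integrable_cosh_integrand:
  assumes "Re z > 0"
  shows "integrable lborel (\<lambda>t. exp (of_real (a * t) - z * of_real (cosh t)))"
  by (rule Bochner_Integration.integrable_bound[OF integrable_exp_cosh[OF assms, of a]])
     (auto simp: norm_exp_eq_Re intro!: borel_measurable_continuous_onI continuous_intros)

text \<open>Reflection of \<open>t\<close> to \<open>-t\<close>. It trades the order
  \<open>a - 1\<close>, negative for \<open>a < 1\<close>, for the positive order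
  \<open>1 - a\<close>.\<close>

lemma cosh_integral_minus: "cosh_integral (- a) z = cosh_integral a z"
  unfolding cosh_integral_def
  by (subst lborel_integral_real_affine[where c = "-1" and t = 0]) auto

lemma exp_cosh_tendsto_0:
  assumes "(x::real) > 0"
  shows "((\<lambda>t. exp (a * t - x * cosh t)) \<longlongrightarrow> 0) at_top"
proof (rule tendsto_sandwich[where f = "\<lambda>_. 0"])
  show "\<forall>\<^sub>F t in at_top. exp (a * t - x * cosh t) \<le> exp (\<bar>a\<bar> * t - x * (exp t / 2))"
    using eventually_ge_at_top[of 0]
  proof eventually_elim
    case (elim t)
    have "a * t \<le> \<bar>a\<bar> * t" using elim by (intro mult_right_mono) auto
    moreover have "x * (exp t / 2) \<le> x * cosh t"
      using assms by (intro mult_left_mono) (auto simp: cosh_def)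
    ultimately show ?case by simp
  qed
  show "((\<lambda>t. exp (\<bar>a\<bar> * t - x * (exp t / 2))) \<longlongrightarrow> 0) at_top"
  proof (cases "a = 0")
    case True
    then show ?thesis using assms by real_asymp
  next
    case False
    define b where "b = \<bar>a\<bar>"
    have "b > 0" using False by (simp add: b_def)
    then show ?thesis using assms unfolding b_def [symmetric] by real_asymp
  qed
qed auto

text \<open>The derivative of \<open>exp (a t - z cosh t)\<close> integrates to 0 because the
  boundary values vanish; the \<open>sinh t\<close> in it splits into the orders
  \<open>a + 1\<close> and \<open>a - 1\<close>.\<close>

lemma cosh_integral_recurrence:
  assumes z: "Re z > 0"
  shows "2 * of_real a * cosh_integral a z = z * (cosh_integral (a + 1) z - cosh_integral (a - 1) z)"
proof -
  define F where "F = (\<lambda>b t. exp (of_real (b * t) - z * of_real (cosh t)))"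
  define f where "f = (\<lambda>t. (of_real a - z * of_real (sinh t)) * F a t)"
  have J: "cosh_integral b z = integral\<^sup>L lborel (F b)" for b
    by (simp only: cosh_integral_def F_def)
  have F: "integrable lborel (F b)" for b
    using integrable_cosh_integrand[OF z] by (simp add: F_def)
  have shift: "F (b + s) t = exp (of_real (s * t)) * F b t" for b s t
    by (simp add: F_def algebra_simps flip: exp_add)
  have split: "f t = of_real a * F a t - z / 2 * (F (a + 1) t - F (a - 1) t)" for t
    using shift[of a 1 t] shift[of a "-1" t]
    by (simp add: f_def sinh_def algebra_simps flip: exp_of_real)
  have intf: "integrable lborel f"
    unfolding split[abs_def] using F by (intro Bochner_Integration.integrable_diff integrable_mult_right)
  have lim_top: "(F b \<longlongrightarrow> 0) at_top" for b
    by (rule tendsto_norm_zero_cancel) (use exp_cosh_tendsto_0[OF z] in \<open>simp add: F_def norm_exp_eq_Re\<close>)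
  have lim_bot: "(F b \<longlongrightarrow> 0) at_bot" for b
    using lim_top[of "-b"] unfolding filterlim_at_bot_mirror by (simp add: F_def)
  have "(LBINT t=-\<infinity>..\<infinity>. f t) = 0 - 0"
  proof (rule interval_integral_FTC_integrable)
    show "(F a has_vector_derivative f t) (at t)" for t
    proof -
      have "((\<lambda>t. of_real (a * t) - z * of_real (cosh t)) has_vector_derivative
          of_real a - z * of_real (sinh t)) (at t)"
        by (intro has_vector_derivative_diff has_vector_derivative_mult_right has_vector_derivative_of_real)
           (auto intro!: derivative_eq_intros)
      from field_vector_diff_chain_at[OF this DERIV_exp]
      show ?thesis by (simp add: F_def f_def comp_def)
    qed
    show "isCont f t" for t
      unfolding f_def F_def by (intro continuous_intros)
  qed (use intf lim_top lim_bot in \<open>auto simp: set_integrable_def ereal_tendsto_simps\<close>)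
  then have "integral\<^sup>L lborel f = 0"
    by (simp add: interval_lebesgue_integral_def set_lebesgue_integral_def)
  moreover have "integral\<^sup>L lborel f =
      of_real a * cosh_integral a z - z / 2 * (cosh_integral (a + 1) z - cosh_integral (a - 1) z)"
    using F unfolding split[abs_def] J by simp
  ultimately show ?thesis by (simp add: field_simps)
qed

text \<open>Differentiation under the integral sign brings down \<open>- cosh t\<close>, whose two
  exponentials shift the order by 1 either way.\<close>

lemma has_field_derivative_cosh_integral:
  assumes z: "Re z > 0"
  shows "(cosh_integral a has_field_derivative - (cosh_integral (a + 1) z + cosh_integral (a - 1) z) / 2) (at z)"
proof -
  define F where "F = (\<lambda>b w t. exp (of_real (b * t) - w * of_real (cosh t)) :: complex)"
  have J: "cosh_integral b z = integral\<^sup>L lborel (F b z)" for b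
    by (simp only: cosh_integral_def F_def)
  \<comment> \<open>Half of \<open>Re z\<close> as radius leaves \<open>Re w > r\<close> on the
    ball, so one majorant, taken at the real point \<open>r\<close>, serves all
    \<open>w\<close>.\<close>
  define r where "r = Re z / 2"
  have r: "r > 0" using z by (simp add: r_def)
  have F: "integrable lborel (F b w)" if "Re w > 0" for b w
    using integrable_cosh_integrand[OF that] by (simp add: F_def)
  have Re_w: "Re w > r" if "w \<in> ball z r" for w
    using that abs_Re_le_cmod[of "z - w"] by (auto simp: dist_norm r_def)
  have shift: "F (b + s) w t = exp (of_real (s * t)) * F b w t" for b s w t
    by (simp add: F_def algebra_simps flip: exp_add)
  have split: "of_real (cosh t) * F a w t = (F (a + 1) w t + F (a - 1) w t) / 2" for w t
    using shift[of a 1 w t] shift[of a "-1" w t]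
    by (simp add: cosh_def algebra_simps add_divide_distrib flip: exp_of_real)
  have "((\<lambda>w. integral\<^sup>L lborel (F a w)) has_field_derivative
      (LINT t|lborel. - of_real (cosh t) * F a z t)) (at z)"
  proof (rule has_field_derivative_integral[OF r])
    show "((\<lambda>w. F a w t) has_field_derivative - of_real (cosh t) * F a w t) (at w)" for w t
      unfolding F_def by (auto intro!: derivative_eq_intros)
    have "integrable lborel (\<lambda>t. norm (of_real (cosh t) * F a (of_real r) t))"
      unfolding split using F r by (intro integrable_norm Bochner_Integration.integrable_add integrable_divide) auto
    then show "integrable lborel (\<lambda>t. cosh t * exp (a * t - r * cosh t))"
      by (simp add: F_def norm_mult norm_exp_eq_Re del: of_real_mult)
    show "norm (- of_real (cosh t) * F a w t) \<le> cosh t * exp (a * t - r * cosh t)"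
      if "w \<in> ball z r" for w t
      using Re_w[OF that] by (simp add: F_def norm_mult norm_exp_eq_Re)
    show "integrable lborel (F a w)" if "w \<in> ball z r" for w
      using Re_w[OF that] r by (intro F) auto
    show "(\<lambda>t. - of_real (cosh t) * F a z t) \<in> borel_measurable lborel"
      unfolding F_def by (auto intro!: borel_measurable_continuous_onI continuous_intros)
  qed
  moreover have "(LINT t|lborel. - of_real (cosh t) * F a z t) = - (cosh_integral (a + 1) z + cosh_integral (a - 1) z) / 2"
    using F[OF z] unfolding J minus_mult_left[symmetric] split by (simp add: field_simps)
  ultimately show ?thesis
    by (simp only: cosh_integral_def [abs_def] F_def)
qed

lemma cosh_integral_of_real:
  "cosh_integral a (of_real x) = of_real (LINT t|lborel. exp (a * t - x * cosh t))"
  unfolding cosh_integral_def integral_complex_of_real [symmetric]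
  by (simp flip: exp_of_real)

text \<open>Translating \<open>t\<close> by \<open>- ln (x/2)\<close> turns \<open>x cosh t\<close>
  into \<open>exp t + (x/2)^2 exp (-t)\<close>. This exposes the Gamma integrand times a factor
  below 1 that tends to 1 as \<open>x\<close> tends to 0; the limit at 0 and the strict bound both
  come from this form.\<close>

lemma cosh_integral_real_shift:
  assumes x: "x > 0"
  shows "cosh_integral a (of_real x) =
      of_real ((x/2) powr (- a) * (LINT t|lborel. exp (a * t - exp t - (x/2)\<^sup>2 * exp (- t))))"
proof -
  have "cosh_integral a (of_real x) = of_real (LINT t|lborel. exp (a * t - x * cosh t))"
    by (simp add: cosh_integral_of_real)
  also have "(LINT t|lborel. exp (a * t - x * cosh t)) =
      (LINT t|lborel. exp (a * (- ln (x/2) + 1 * t) - x * cosh (- ln (x/2) + 1 * t)))"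
    by (subst lborel_integral_real_affine[where c = 1 and t = "- ln (x/2)"]) auto
  also have "\<dots> = (LINT t|lborel. (x/2) powr (- a) * exp (a * t - exp t - (x/2)\<^sup>2 * exp (- t)))"
  proof (rule Bochner_Integration.integral_cong[OF refl])
    fix t
    have "exp (- ln (x/2) + t) = 2/x * exp t" "exp (- (- ln (x/2) + t)) = x/2 * exp (-t)"
      using x by (simp_all add: exp_add exp_minus exp_diff field_simps)
    then have "x * cosh (- ln (x/2) + t) = exp t + (x/2)\<^sup>2 * exp (-t)"
      unfolding cosh_def using x by (simp add: field_simps power2_eq_square)
    moreover have "(x/2) powr (- a) = exp (- a * ln (x/2))" using x by (simp add: powr_def)
    ultimately show "exp (a * (- ln (x/2) + 1 * t) - x * cosh (- ln (x/2) + 1 * t)) =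
        (x/2) powr (- a) * exp (a * t - exp t - (x/2)\<^sup>2 * exp (- t))"
      by (simp add: algebra_simps flip: exp_add)
  qed
  finally show ?thesis by simp
qed

text \<open>The extra factor of the shifted integrand tends to 1 and never exceeds 1, so the Gamma
  integrand dominates. The limit later fixes a Wronskian constant.\<close>

lemma cosh_integral_at_0:
  assumes a: "a > 0"
  shows "((\<lambda>x. of_real ((x/2) powr a) * cosh_integral a (of_real x)) \<longlongrightarrow> of_real (Gamma a)) (at_right 0)"
proof -
  have "((\<lambda>x. LINT t|lborel. exp (a * t - exp t - (x/2)\<^sup>2 * exp (- t))) \<longlongrightarrow>
      (LINT t|lborel. exp (a * t - exp t))) (at_right 0)"
  proof (rule integral_dominated_convergence_within)
    show "integrable lborel (\<lambda>t. exp (a * t - exp t))"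
      using has_bochner_integral_Gamma_exp[OF a] by (simp add: has_bochner_integral_iff)
    show "((\<lambda>x. exp (a * t - exp t - (x/2)\<^sup>2 * exp (- t))) \<longlongrightarrow> exp (a * t - exp t)) (at_right 0)" for t
      by (auto intro!: tendsto_eq_intros)
  qed (auto intro!: borel_measurable_continuous_onI continuous_intros)
  then have "((\<lambda>x. complex_of_real (LINT t|lborel. exp (a * t - exp t - (x/2)\<^sup>2 * exp (- t)))) \<longlongrightarrow>
      of_real (Gamma a)) (at_right 0)"
    using has_bochner_integral_Gamma_exp[OF a] by (intro tendsto_of_real) (simp add: has_bochner_integral_iff)
  moreover have "\<forall>\<^sub>F x in at_right 0. complex_of_real (LINT t|lborel. exp (a * t - exp t - (x/2)\<^sup>2 * exp (- t)))
      = of_real ((x/2) powr a) * cosh_integral a (of_real x)"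
    using eventually_at_right_less[of 0]
  proof eventually_elim
    case (elim x)
    then have "(x/2) powr a * (x/2) powr (- a) = 1" by (simp add: powr_minus)
    then show ?case using elim
      by (simp add: cosh_integral_real_shift flip: mult.assoc of_real_mult)
  qed
  ultimately show ?thesis by (rule Lim_transform_eventually)
qed

text \<open>Passing to norms replaces \<open>z\<close> by \<open>Re z\<close>. In the shifted
  integral the factor \<open>exp (- (x/2)^2 exp (-t))\<close> is below 1 for every \<open>t\<close>,
  so dropping it is strict.\<close>

lemma norm_cosh_integral_less:
  assumes z: "Re z > 0" and a: "a > 0"
  shows "norm (cosh_integral a z) < (2 / Re z) powr a * Gamma a"
proof -
  define x where "x = Re z"
  have x: "x > 0" using z by (simp add: x_def)
  have int: "integrable lborel (\<lambda>t. exp (a * t - exp t))"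
    using has_bochner_integral_Gamma_exp[OF a] by (simp add: has_bochner_integral_iff)
  have "norm (cosh_integral a z) \<le> (LINT t|lborel. exp (a * t - x * cosh t))"
    unfolding cosh_integral_def
    by (rule order_trans[OF integral_norm_bound]) (simp add: norm_exp_eq_Re x_def)
  \<comment> \<open>A side fact rather than a link of the chain: it carries the shift formula,
    stated for complex values, over to the real integral.\<close>
  also have "complex_of_real \<dots> = cosh_integral a (of_real x)"
    by (simp add: cosh_integral_of_real)
  then have "(LINT t|lborel. exp (a * t - x * cosh t)) =
      (x/2) powr (- a) * (LINT t|lborel. exp (a * t - exp t - (x/2)\<^sup>2 * exp (- t)))"
    unfolding cosh_integral_real_shift[OF x] of_real_eq_iff .
  also have "(LINT t|lborel. exp (a * t - exp t - (x/2)\<^sup>2 * exp (- t))) < (LINT t|lborel. exp (a * t - exp t))"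
  proof (rule integral_strict_mono[where A = UNIV])
    show "integrable lborel (\<lambda>t. exp (a * t - exp t - (x/2)\<^sup>2 * exp (- t)))"
      by (rule Bochner_Integration.integrable_bound[OF int])
         (auto intro!: borel_measurable_continuous_onI continuous_intros)
  qed (use x int in auto)
  also have "(LINT t|lborel. exp (a * t - exp t)) = Gamma a"
    using has_bochner_integral_Gamma_exp[OF a] by (simp add: has_bochner_integral_iff)
  finally show ?thesis
    using x by (simp add: x_def powr_minus powr_divide field_simps)
qed

subsection \<open>The power series of the modified Bessel functions\<close>

text \<open>The entire factor of \<open>bessel_I\<close> in the variable \<open>w = z^2 / 4\<close>,
  with the branched power split off.\<close>

definition bessel_series :: "real \<Rightarrow> complex \<Rightarrow> complex" where
  "bessel_series a w = (\<Sum>k. rGamma (of_real a + of_nat k + 1) / fact k * w ^ k)"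

lemma bessel_I_series: "bessel_I a z = (z / 2) powr of_real a * bessel_series a (z\<^sup>2 / 4)"
  by (simp add: bessel_I_def bessel_series_def)

lemma summable_bessel_series:
  "summable (\<lambda>k. rGamma (of_real a + of_nat k + 1) / fact k * w ^ k :: complex)"
\<comment> \<open>Beyond this \<open>N\<close> the norm of \<open>u = a + k + 1\<close> is at least
  \<open>2 * norm w\<close>. Consecutive \<open>rGamma\<close> values differ by the factor
  \<open>u\<close>, whence the ratio 1/2.\<close>
proof (rule summable_ratio_test[where c = "1/2" and N = "nat \<lceil>2 * norm w + \<bar>a\<bar>\<rceil>"])
  fix k :: nat assume "k \<ge> nat \<lceil>2 * norm w + \<bar>a\<bar>\<rceil>"
  then have k: "real k \<ge> 2 * norm w + \<bar>a\<bar>" by linarith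
  define u :: complex where "u = of_real a + of_nat k + 1"
  have u: "u * rGamma (u + 1) = rGamma u" by (rule rGamma_plus1)
  have "norm u = \<bar>a + real k + 1\<bar>"
    unfolding u_def by (metis norm_of_real of_real_1 of_real_add of_real_of_nat_eq)
  with k have nu: "norm u \<ge> 2 * norm w" "norm u > 0" "norm u \<ge> 1" using norm_ge_zero[of w] by linarith+
  have "norm (rGamma (u + 1)) * norm w * 2 \<le> norm (rGamma (u + 1)) * norm u"
    using nu by (simp add: mult_left_mono mult.assoc)
  also have "\<dots> = norm (rGamma u)" by (simp flip: u norm_mult add: mult.commute)
  finally have *: "norm (rGamma (u + 1)) * norm w \<le> norm (rGamma u) / 2" by simp
  have "norm (rGamma (u + 1) / fact (Suc k) * w ^ Suc k) =
      (norm (rGamma (u + 1)) * norm w) * (norm w ^ k / fact k) / real (Suc k)"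
    by (simp add: norm_mult norm_divide norm_power field_simps del: of_nat_Suc)
  also have "\<dots> \<le> (norm (rGamma (u + 1)) * norm w) * (norm w ^ k / fact k) / 1"
    by (intro divide_left_mono) auto
  also have "\<dots> \<le> norm (rGamma u) / 2 * (norm w ^ k / fact k) / 1"
    using * by (intro divide_right_mono mult_right_mono) auto
  finally show "norm (rGamma (of_real a + of_nat (Suc k) + 1) / fact (Suc k) * w ^ Suc k) \<le>
      1 / 2 * norm (rGamma (of_real a + of_nat k + 1) / fact k * w ^ k)"
    by (simp add: u_def norm_mult norm_divide norm_power add_ac)
qed auto

lemma bessel_series_sums:
  "(\<lambda>k. rGamma (of_real a + of_nat k + 1) / fact k * w ^ k) sums bessel_series a w"
  unfolding bessel_series_def using summable_bessel_series by (rule summable_sums)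

text \<open>Termwise differentiation cancels one factor of the factorial, and the index shift inside
  \<open>rGamma\<close> raises the order by one.\<close>

lemma has_field_derivative_bessel_series:
  "(bessel_series a has_field_derivative bessel_series (a + 1) w) (at w)"
proof -
  have "diffs (\<lambda>k. rGamma (of_real a + of_nat k + 1) / fact k) =
      (\<lambda>k. rGamma (of_real (a + 1) + of_nat k + 1) / fact k :: complex)"
    by (rule ext) (simp add: diffs_def add_ac divide_simps del: of_nat_Suc, simp add: add_ac)
  with termdiffs_strong_converges_everywhere[OF summable_bessel_series, of a w] show ?thesis
    unfolding bessel_series_def by simp
qed

lemma continuous_bessel_series: "continuous_on UNIV (bessel_series a)"
  using has_field_derivative_bessel_series
  by (meson DERIV_isCont continuous_at_imp_continuous_on)

lemma bessel_series_0: "bessel_series a 0 = rGamma (of_real a + 1)"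
  using powser_zero[of "\<lambda>k. rGamma (of_real a + of_nat k + 1) / fact k :: complex"]
  by (simp add: bessel_series_def)

text \<open>Split \<open>rGamma (a + k) = (a + k) * rGamma (a + k + 1)\<close>: the part with
  \<open>a\<close> is a multiple of the series, the part with \<open>k\<close> is \<open>w\<close>
  times its derivative.\<close>

lemma bessel_series_lower:
  "bessel_series (a - 1) w = of_real a * bessel_series a w + w * bessel_series (a + 1) w"
proof -
  define c where "c = (\<lambda>k. rGamma (of_real a + of_nat k + 1) / fact k :: complex)"
  have "(\<lambda>k. of_nat (Suc k) * c (Suc k) * w ^ Suc k) = (\<lambda>k. w * (rGamma (of_real (a + 1) + of_nat k + 1) / fact k * w ^ k))"
    by (rule ext) (simp add: c_def add_ac divide_simps del: of_nat_Suc, simp add: add_ac)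
  with sums_mult[OF bessel_series_sums[of "a + 1" w], of w]
  have "(\<lambda>k. of_nat (Suc k) * c (Suc k) * w ^ Suc k) sums (w * bessel_series (a + 1) w)" by simp
  \<comment> \<open>The term at \<open>k = 0\<close> vanishes, so the index shift leaves the sum
    unchanged.\<close>
  then have "(\<lambda>k. of_nat k * c k * w ^ k) sums (w * bessel_series (a + 1) w)"
    by (subst (asm) sums_Suc_iff) simp
  from sums_add[OF sums_mult[OF bessel_series_sums[of a w], of "of_real a"] this]
  have "(\<lambda>k. (of_real a + of_nat k) * c k * w ^ k) sums
      (of_real a * bessel_series a w + w * bessel_series (a + 1) w)"
    by (simp add: c_def algebra_simps add_divide_distrib)
  moreover have "(of_real a + of_nat k) * c k = rGamma (of_real (a - 1) + of_nat k + 1) / fact k" for k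
    using rGamma_plus1[of "of_real a + of_nat k :: complex"] by (simp add: c_def)
  ultimately show ?thesis
    using bessel_series_sums[of "a - 1" w] by (simp add: sums_unique2)
qed

lemma bessel_I_recurrence:
  assumes z: "z \<noteq> 0"
  shows "bessel_I (a - 1) z = bessel_I (a + 1) z + 2 * of_real a / z * bessel_I a z"
proof -
  have 1: "(z/2) powr of_real (a + 1) = (z/2) powr of_real (a - 1) * (z/2)\<^sup>2"
    using z powr_add[of "z/2" "of_real (a - 1)" "of_nat 2"] by (simp add: powr_nat add.commute)
  have 2: "(z/2) powr of_real a = (z/2) powr of_real (a - 1) * (z/2)"
    using z powr_add[of "z/2" "of_real (a - 1)" "of_nat 1"] by (simp add: powr_nat)
  show ?thesis
    unfolding bessel_I_series 1 2 bessel_series_lower[of a]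
    using z by (simp add: field_simps power2_eq_square)
qed

text \<open>The product rule gives the form with order \<open>a + 1\<close>; the recurrence converts
  it to order \<open>a - 1\<close>. \<open>Re z > 0\<close> keeps \<open>z / 2\<close> off the
  branch cut.\<close>

lemma has_field_derivative_bessel_I:
  assumes z: "Re z > 0"
  shows "(bessel_I a has_field_derivative bessel_I (a + 1) z + of_real a / z * bessel_I a z) (at z)"
    and "(bessel_I a has_field_derivative bessel_I (a - 1) z - of_real a / z * bessel_I a z) (at z)"
proof -
  have z0: "z \<noteq> 0" "z / 2 \<notin> \<real>\<^sub>\<le>\<^sub>0" using z by (auto simp: complex_nonpos_Reals_iff)
  have 1: "(z/2) powr of_real (a + 1) = (z/2) powr of_real a * (z/2)"
    using z0 powr_add[of "z/2" "of_real a" "of_nat 1"] by (simp add: powr_nat)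
  have 2: "(z/2) powr of_real a = (z/2) powr (of_real a - 1) * (z/2)"
    using z0 powr_add[of "z/2" "of_real a - 1" "of_nat 1"] by (simp add: powr_nat)
  have "((\<lambda>z. bessel_series a (z\<^sup>2/4)) has_field_derivative bessel_series (a + 1) (z\<^sup>2/4) * (z/2)) (at z)"
    by (rule DERIV_chain2[OF has_field_derivative_bessel_series]) (auto intro!: derivative_eq_intros)
  moreover have "((\<lambda>z. (z/2) powr of_real a) has_field_derivative
      (of_real a * (z/2) powr (of_real a - 1) * (1/2))) (at z)"
    using z0 by (auto intro!: derivative_eq_intros)
  ultimately have "(bessel_I a has_field_derivative
      of_real a * (z/2) powr (of_real a - 1) * (1/2) * bessel_series a (z\<^sup>2/4) +
      bessel_series (a + 1) (z\<^sup>2/4) * (z/2) * (z/2) powr of_real a) (at z)"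
    unfolding bessel_I_series [abs_def] by (intro DERIV_mult)
  moreover have "of_real a * (z/2) powr (of_real a - 1) * (1/2) * bessel_series a (z\<^sup>2/4) +
      bessel_series (a + 1) (z\<^sup>2/4) * (z/2) * (z/2) powr of_real a =
      bessel_I (a + 1) z + of_real a / z * bessel_I a z"
    unfolding bessel_I_series 1 using z0 by (simp add: 2 field_simps)
  ultimately show *: "(bessel_I a has_field_derivative bessel_I (a + 1) z + of_real a / z * bessel_I a z) (at z)"
    by simp
  then show "(bessel_I a has_field_derivative bessel_I (a - 1) z - of_real a / z * bessel_I a z) (at z)"
    using bessel_I_recurrence[OF z0(1), of a] by (simp add: algebra_simps)
qed

text \<open>In the derivative of the bracket the mixed products cancel and \<open>- 1 / z\<close>
  times the bracket remains, so the factor \<open>z\<close> makes it constant on the convex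
  half-plane. The limit along the positive reals identifies the constant.\<close>

lemma bessel_I_wronskian_constant:
  assumes f: "\<And>z. Re z > 0 \<Longrightarrow> (f has_field_derivative - of_real a / z * f z - g z) (at z)"
    and g: "\<And>z. Re z > 0 \<Longrightarrow> (g has_field_derivative of_real (a - 1) / z * g z - f z) (at z)"
    and lim: "((\<lambda>x. of_real x * (bessel_I a (of_real x) * g (of_real x) + bessel_I (a - 1) (of_real x) * f (of_real x)))
      \<longlongrightarrow> L) (at_right 0)"
    and z: "Re z > 0"
  shows "z * (bessel_I a z * g z + bessel_I (a - 1) z * f z) = L"
proof -
  define W where "W = (\<lambda>z. z * (bessel_I a z * g z + bessel_I (a - 1) z * f z))"
  have "(W has_field_derivative 0) (at z within {z. Re z > 0})" if "z \<in> {z. Re z > 0}" for z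
  proof -
    have z: "Re z > 0" "z \<noteq> 0" using that by auto
    have I: "(bessel_I a has_field_derivative bessel_I (a - 1) z - of_real a / z * bessel_I a z) (at z)"
      "(bessel_I (a - 1) has_field_derivative bessel_I a z + of_real (a - 1) / z * bessel_I (a - 1) z) (at z)"
      using has_field_derivative_bessel_I(2)[OF z(1), of a] has_field_derivative_bessel_I(1)[OF z(1), of "a - 1"]
      by simp_all
    have "(W has_field_derivative 0) (at z)"
      unfolding W_def
      by (rule derivative_eq_intros I f[OF z(1)] g[OF z(1)] refl)+ (use z in \<open>simp add: field_simps\<close>)
    then show ?thesis by (rule has_field_derivative_at_within)
  qed
  then obtain c where c: "\<And>z. Re z > 0 \<Longrightarrow> W z = c"
    using has_field_derivative_zero_constant[OF convex_halfspace_Re_gt[of 0], of W] by auto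
  have "((\<lambda>x. W (of_real x)) \<longlongrightarrow> L) (at_right 0)"
    using lim by (simp add: W_def)
  moreover have "((\<lambda>x. W (of_real x)) \<longlongrightarrow> c) (at_right 0)"
    by (rule tendsto_eventually) (use eventually_at_right_less[of "0::real"] c in \<open>auto elim: eventually_mono\<close>)
  ultimately have "L = c" by (intro tendsto_unique) auto
  with c z show ?thesis by (simp add: W_def)
qed

subsection \<open>Integral representation of the Bessel function of the second kind\<close>

lemma bessel_I_of_real:
  assumes "x > 0"
  shows "bessel_I a (of_real x) = of_real ((x/2) powr a) * bessel_series a (of_real ((x/2)\<^sup>2))"
proof -
  have "(complex_of_real x / 2) powr of_real a = of_real ((x/2) powr a)"
    using assms powr_of_real[of "x/2" a] by simp
  then show ?thesis by (simp add: bessel_I_series power_divide)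
qed

lemma bessel_series_at_0:
  "((\<lambda>x. bessel_series a (of_real ((x/2)\<^sup>2))) \<longlongrightarrow> rGamma (of_real (a + 1))) (at_right 0)"
proof -
  have "((\<lambda>x. bessel_series a (of_real ((x/2)\<^sup>2))) \<longlongrightarrow> bessel_series a (of_real ((0/2)\<^sup>2))) (at_right 0)"
    by (intro continuous_on_tendsto_compose[OF continuous_bessel_series] tendsto_intros) auto
  then show ?thesis by (simp add: bessel_series_0)
qed

lemma half_powr_at_0:
  assumes "a > 0"
  shows "((\<lambda>x. of_real ((x/2) powr a)) \<longlongrightarrow> (0::complex)) (at_right 0)"
proof -
  have "((\<lambda>x. (x/2) powr a) \<longlongrightarrow> (0/2) powr a) (at_right (0::real))"
    using assms by (intro tendsto_powr2 tendsto_intros) (auto intro!: eventually_at_right_less[THEN eventually_mono])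
  from tendsto_of_real[OF this] show ?thesis by simp
qed

text \<open>Near 0 the first product is of order \<open>x powr (2 * a)\<close> and vanishes, while
  the second tends to \<open>2 * rGamma a * Gamma a = 2\<close>. For \<open>0 < a < 1\<close> both
  \<open>a\<close> and \<open>1 - a\<close> are positive, as the limits of
  \<open>cosh_integral\<close> at 0 require.\<close>

lemma bessel_I_cosh_integral_wronskian:
  assumes a: "0 < a" "a < 1" and z: "Re z > 0"
  shows "z * (bessel_I a z * cosh_integral (a - 1) z + bessel_I (a - 1) z * cosh_integral a z) = 2"
proof (rule bessel_I_wronskian_constant[OF _ _ _ z])
  fix z assume z: "Re z > 0"
  then have z0: "z \<noteq> 0" by auto
  \<comment> \<open>The recurrence eliminates the order \<open>a + 1\<close> here, and
    \<open>a - 2\<close> in the second equation, so the two orders form a closed system.\<close>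
  have D: "- (cosh_integral (a + 1) z + cosh_integral (a - 1) z) / 2 =
      - of_real a / z * cosh_integral a z - cosh_integral (a - 1) z"
    using cosh_integral_recurrence[OF z, of a] z0 by (simp add: field_simps)
  show "(cosh_integral a has_field_derivative - of_real a / z * cosh_integral a z - cosh_integral (a - 1) z) (at z)"
    using has_field_derivative_cosh_integral[OF z, of a] unfolding D .
  have D: "- (cosh_integral (a - 1 + 1) z + cosh_integral (a - 1 - 1) z) / 2 =
      of_real (a - 1) / z * cosh_integral (a - 1) z - cosh_integral a z"
    using cosh_integral_recurrence[OF z, of "a - 1"] z0 by (simp add: field_simps)
  show "(cosh_integral (a - 1) has_field_derivative of_real (a - 1) / z * cosh_integral (a - 1) z - cosh_integral a z) (at z)"
    using has_field_derivative_cosh_integral[OF z, of "a - 1"] unfolding D .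
next
  define S where "S = (\<lambda>b x. bessel_series b (of_real ((x/2)\<^sup>2)))"
  define H where "H = (\<lambda>b x. of_real ((x/2) powr b) * cosh_integral b (of_real x))"
  \<comment> \<open>This is the Wronskian with all powers of \<open>x/2\<close> collected; the 2
    comes from \<open>x = 2 * (x/2)\<close>, and the order \<open>a - 1\<close> has been reflected
    to \<open>1 - a\<close>.\<close>
  have "((\<lambda>x. 2 * of_real ((x/2) powr (2 * a)) * S a x * H (1 - a) x + 2 * S (a - 1) x * H a x) \<longlongrightarrow>
      2 * 0 * rGamma (of_real (a + 1)) * of_real (Gamma (1 - a)) + 2 * rGamma (of_real (a - 1 + 1)) * of_real (Gamma a))
      (at_right 0)"
    unfolding S_def H_def using a
    by (intro tendsto_intros half_powr_at_0 bessel_series_at_0 cosh_integral_at_0) auto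
  also have "2 * 0 * rGamma (of_real (a + 1)) * of_real (Gamma (1 - a)) + 2 * rGamma (of_real (a - 1 + 1)) * of_real (Gamma a)
      = (2 :: complex)"
    using less_imp_neq[OF Gamma_real_pos[OF a(1)], THEN not_sym]
    by (simp add: rGamma_inverse_Gamma Gamma_complex_of_real flip: of_real_mult of_real_inverse)
  finally show "((\<lambda>x. of_real x * (bessel_I a (of_real x) * cosh_integral (a - 1) (of_real x) +
      bessel_I (a - 1) (of_real x) * cosh_integral a (of_real x))) \<longlongrightarrow> 2) (at_right 0)"
  proof (rule Lim_transform_eventually)
    show "\<forall>\<^sub>F x in at_right 0. 2 * of_real ((x/2) powr (2 * a)) * S a x * H (1 - a) x + 2 * S (a - 1) x * H a x =
      of_real x * (bessel_I a (of_real x) * cosh_integral (a - 1) (of_real x) +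
      bessel_I (a - 1) (of_real x) * cosh_integral a (of_real x))"
      using eventually_at_right_less[of 0]
    proof eventually_elim
      case (elim x)
      have 1: "(x/2) powr (2 * a) * (x/2) powr (1 - a) = (x/2) * (x/2) powr a"
        "(x/2) powr a = (x/2) powr (a - 1) * (x/2)"
        unfolding powr_add [symmetric] using elim powr_mult_base[of "x/2" a]
        by (simp_all add: powr_diff add.commute)
      have "2 * of_real ((x/2) powr (2 * a)) * S a x * H (1 - a) x =
          2 * of_real ((x/2) powr (2 * a) * (x/2) powr (1 - a)) * S a x * cosh_integral (a - 1) (of_real x)"
        using cosh_integral_minus[of "1 - a" "of_real x"] by (simp add: H_def)
      also have "\<dots> = of_real x * (bessel_I a (of_real x) * cosh_integral (a - 1) (of_real x))"
        unfolding 1(1) using elim by (simp add: bessel_I_of_real S_def)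
      finally have "2 * of_real ((x/2) powr (2 * a)) * S a x * H (1 - a) x =
          of_real x * (bessel_I a (of_real x) * cosh_integral (a - 1) (of_real x))" .
      moreover have "2 * S (a - 1) x * H a x = of_real x * (bessel_I (a - 1) (of_real x) * cosh_integral a (of_real x))"
        unfolding H_def 1(2) using elim by (simp add: bessel_I_of_real S_def)
      ultimately show ?case by (simp add: distrib_left)
    qed
  qed
qed

text \<open>The pair \<open>bessel_I (- a)\<close>, \<open>- bessel_I (1 - a)\<close> solves the
  same system. At 0 one product is of order \<open>x^2\<close>; the other gives
  \<open>2 * rGamma a * rGamma (1 - a)\<close>, evaluated by the reflection formula.\<close>

lemma bessel_I_wronskian:
  assumes a: "0 < a" "a < 1" and z: "Re z > 0"
  shows "z * (bessel_I (a - 1) z * bessel_I (- a) z - bessel_I a z * bessel_I (1 - a) z) = of_real (2 * sin (pi * a) / pi)"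
proof -
  have "z * (bessel_I a z * (- bessel_I (1 - a) z) + bessel_I (a - 1) z * bessel_I (- a) z) = of_real (2 * sin (pi * a) / pi)"
  proof (rule bessel_I_wronskian_constant[OF _ _ _ z])
    fix z assume z: "Re z > 0"
    show "(bessel_I (- a) has_field_derivative - of_real a / z * bessel_I (- a) z - - bessel_I (1 - a) z) (at z)"
      using has_field_derivative_bessel_I(1)[OF z, of "- a"] by (simp add: add.commute)
    show "((\<lambda>z. - bessel_I (1 - a) z) has_field_derivative of_real (a - 1) / z * - bessel_I (1 - a) z - bessel_I (- a) z) (at z)"
      using DERIV_minus[OF has_field_derivative_bessel_I(2)[OF z, of "1 - a"]] by (simp add: algebra_simps)
  next
    define S where "S = (\<lambda>b x. bessel_series b (of_real ((x/2)\<^sup>2)))"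
    have "((\<lambda>x. 2 * (S (a - 1) x * S (- a) x) - 2 * (of_real (x/2) * of_real (x/2)) * (S a x * S (1 - a) x)) \<longlongrightarrow>
        2 * (rGamma (of_real (a - 1 + 1)) * rGamma (of_real (- a + 1))) -
        2 * (of_real (0/2) * of_real (0/2)) * (rGamma (of_real (a + 1)) * rGamma (of_real (1 - a + 1)))) (at_right 0)"
      unfolding S_def by (intro tendsto_intros bessel_series_at_0) auto
    also have "2 * (rGamma (of_real (a - 1 + 1)) * rGamma (of_real (- a + 1))) -
        2 * (of_real (0/2) * of_real (0/2)) * (rGamma (of_real (a + 1)) * rGamma (of_real (1 - a + 1))) =
        complex_of_real (2 * sin (pi * a) / pi)"
      using rGamma_reflection_complex[of "of_real a"] by (simp add: sin_of_real [symmetric])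
    finally show "((\<lambda>x. of_real x * (bessel_I a (of_real x) * - bessel_I (1 - a) (of_real x) +
        bessel_I (a - 1) (of_real x) * bessel_I (- a) (of_real x))) \<longlongrightarrow> complex_of_real (2 * sin (pi * a) / pi)) (at_right 0)"
    proof (rule Lim_transform_eventually)
      show "\<forall>\<^sub>F x in at_right 0. 2 * (S (a - 1) x * S (- a) x) - 2 * (of_real (x/2) * of_real (x/2)) * (S a x * S (1 - a) x) =
        of_real x * (bessel_I a (of_real x) * - bessel_I (1 - a) (of_real x) +
        bessel_I (a - 1) (of_real x) * bessel_I (- a) (of_real x))"
        using eventually_at_right_less[of 0]
      proof eventually_elim
        case (elim x)
        have "(x/2) powr a * (x/2) powr (1 - a) = x/2" "(x/2) powr (a - 1) * (x/2) powr (- a) = 2 / x"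
          unfolding powr_add [symmetric] using elim by (simp_all add: powr_neg_one)
        then have "of_real x * (bessel_I a (of_real x) * bessel_I (1 - a) (of_real x)) =
            of_real (x * (x/2)) * (S a x * S (1 - a) x)"
          "of_real x * (bessel_I (a - 1) (of_real x) * bessel_I (- a) (of_real x)) =
            of_real (x * (2/x)) * (S (a - 1) x * S (- a) x)"
          using elim by (simp_all add: bessel_I_of_real S_def mult_ac
            flip: of_real_mult of_real_divide mult.assoc[of "of_real _" "of_real _"])
        then show ?case using elim by (simp add: algebra_simps)
      qed
    qed
  qed
  then show ?thesis by (simp add: algebra_simps)
qed

lemma cosh_integral_eq_bessel_I_unit:
  assumes a: "0 < a" "a < 1" and z: "Re z > 0"
  shows "of_real (sin (pi * a)) * cosh_integral a z = of_real pi * (bessel_I (- a) z - bessel_I a z)"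
proof -
  have 1: "z * (bessel_I a z * cosh_integral (a - 1) z + bessel_I (a - 1) z * cosh_integral a z) = 2"
    using a z by (rule bessel_I_cosh_integral_wronskian)
  \<comment> \<open>The same Wronskian at \<open>1 - a\<close>, with the orders of the integrals
    reflected back.\<close>
  have 2: "z * (bessel_I (1 - a) z * cosh_integral a z + bessel_I (- a) z * cosh_integral (a - 1) z) = 2"
    using bessel_I_cosh_integral_wronskian[of "1 - a" z] a z
      cosh_integral_minus[of a z] cosh_integral_minus[of "a - 1" z] by simp
  \<comment> \<open>Cramer's rule: these weights eliminate \<open>cosh_integral (a - 1) z\<close>,
    and the determinant left over is \<open>bessel_I_wronskian\<close>.\<close>
  have 3: "cosh_integral a z * of_real (2 * sin (pi * a) / pi) =
      bessel_I (- a) z * (z * (bessel_I a z * cosh_integral (a - 1) z + bessel_I (a - 1) z * cosh_integral a z)) -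
      bessel_I a z * (z * (bessel_I (1 - a) z * cosh_integral a z + bessel_I (- a) z * cosh_integral (a - 1) z))"
    unfolding bessel_I_wronskian[OF a z, symmetric] by (simp add: algebra_simps)
  have "of_real (sin (pi * a)) * cosh_integral a z =
      of_real pi / 2 * (cosh_integral a z * of_real (2 * sin (pi * a) / pi))" by simp
  then show ?thesis unfolding 3 1 2 by (simp add: algebra_simps)
qed

text \<open>Because the sine changes sign at each unit step, both sides of \<open>E\<close> satisfy
  the same three-term recurrence. Hence two consecutive orders are carried through the
  induction.\<close>

lemma cosh_integral_eq_bessel_I_add_nat:
  assumes a: "0 < a" "a < 1" and z: "Re z > 0"
  defines "E \<equiv> \<lambda>b. of_real (sin (pi * b)) * cosh_integral b z = of_real pi * (bessel_I (- b) z - bessel_I b z)"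
  shows "E (a + real n - 1) \<and> E (a + real n)"
proof (induction n)
  case 0
  have "E (1 - a)" "E a"
    using cosh_integral_eq_bessel_I_unit[of "1 - a" z] cosh_integral_eq_bessel_I_unit[of a z] a z
    by (simp_all add: E_def)
  \<comment> \<open>Both sides of \<open>E b\<close> change sign when \<open>b\<close> becomes
    \<open>- b\<close>, so \<open>E (a - 1)\<close> follows from \<open>E (1 - a)\<close>.\<close>
  moreover have "sin (pi * (a - 1)) = - sin (pi * (1 - a))"
    by (metis minus_diff_eq mult_minus_right sin_minus)
  ultimately show ?case
    using cosh_integral_minus[of "a - 1" z] by (simp add: E_def algebra_simps)
next
  case (Suc n)
  define b where "b = a + real n"
  have b: "E (b - 1)" "E b" using Suc by (simp_all add: b_def)
  have z0: "z \<noteq> 0" using z by auto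
  have s: "sin (pi * (b + 1)) = - sin (pi * b)" "sin (pi * (b - 1)) = - sin (pi * b)"
    by (simp_all add: distrib_left right_diff_distrib sin_add sin_diff)
  have I1: "bessel_I (b + 1) z = bessel_I (b - 1) z - 2 * of_real b / z * bessel_I b z"
    using bessel_I_recurrence[OF z0, of b] by simp
  have I2: "bessel_I (- (b + 1)) z = bessel_I (- (b - 1)) z - 2 * of_real b / z * bessel_I (- b) z"
    using bessel_I_recurrence[OF z0, of "- b"] minus_diff_commute[of b 1] by (simp add: algebra_simps)
  have J: "cosh_integral (b + 1) z = cosh_integral (b - 1) z + 2 * of_real b / z * cosh_integral b z"
    using cosh_integral_recurrence[OF z, of b] z0 by (simp add: field_simps)
  have "of_real (sin (pi * (b + 1))) * cosh_integral (b + 1) z =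
      of_real (sin (pi * (b - 1))) * cosh_integral (b - 1) z
        - 2 * of_real b / z * (of_real (sin (pi * b)) * cosh_integral b z)"
    unfolding J s by (simp add: algebra_simps)
  also have "\<dots> = of_real pi * (bessel_I (- (b - 1)) z - bessel_I (b - 1) z)
        - 2 * of_real b / z * (of_real pi * (bessel_I (- b) z - bessel_I b z))"
    using b unfolding E_def by simp
  also have "\<dots> = of_real pi * (bessel_I (- (b + 1)) z - bessel_I (b + 1) z)"
    unfolding I1 I2 by (simp add: algebra_simps)
  finally have "E (b + 1)" by (simp only: E_def)
  with b show ?case by (simp add: b_def add_ac)
qed

lemma cosh_integral_eq_bessel_I:
  assumes a: "a > 0" "a \<notin> \<int>" and z: "Re z > 0"
  shows "of_real pi / 2 * (bessel_I (- a) z - bessel_I a z) / of_real (sin (a * pi)) = cosh_integral a z / 2"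
proof -
  define n where "n = nat \<lfloor>a\<rfloor>"
  have n: "a = frac a + real n" using a by (simp add: n_def frac_def)
  have "0 < frac a" "frac a < 1" using a by (simp_all add: frac_lt_1)
  from cosh_integral_eq_bessel_I_add_nat[OF this z, of n]
  have "of_real (sin (pi * a)) * cosh_integral a z = of_real pi * (bessel_I (- a) z - bessel_I a z)"
    unfolding n[symmetric] by blast
  moreover have "sin (pi * a) \<noteq> 0"
    using a unfolding sin_zero_iff_int2 by (auto simp: mult.commute)
  ultimately show ?thesis by (simp add: mult.commute[of a] flip: mult.assoc)
    (simp add: divide_simps mult_ac)
qed

text \<open>For orders within 1 of \<open>a\<close>, the integrand is dominated by the sum of those
  at \<open>a + 1\<close> and \<open>a - 1\<close>, one for each sign of \<open>t\<close>.\<close>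

lemma cosh_integral_order_tendsto:
  assumes z: "Re z > 0"
  shows "((\<lambda>b. cosh_integral b z) \<longlongrightarrow> cosh_integral a z) (at a)"
proof -
  have "((\<lambda>b. cosh_integral b z) \<longlongrightarrow> cosh_integral a z) (at a within ball a 1)"
    unfolding cosh_integral_def
  proof (rule integral_dominated_convergence_within)
    show "integrable lborel (\<lambda>t. exp ((a + 1) * t - Re z * cosh t) + exp ((a - 1) * t - Re z * cosh t))"
      by (intro Bochner_Integration.integrable_add integrable_exp_cosh z)
    show "norm (exp (of_real (b * t) - z * of_real (cosh t))) \<le>
        exp ((a + 1) * t - Re z * cosh t) + exp ((a - 1) * t - Re z * cosh t)"
      if "b \<in> ball a 1 - {a}" for b t
    proof -
      have "b * t \<le> (a + 1) * t \<or> b * t \<le> (a - 1) * t"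
        using that mult_right_mono[of b "a + 1" t] mult_right_mono_neg[of "a - 1" b t]
        by (cases "t \<ge> 0") (auto simp: dist_real_def)
      then have "exp (b * t - Re z * cosh t) \<le> exp ((a + 1) * t - Re z * cosh t) \<or>
          exp (b * t - Re z * cosh t) \<le> exp ((a - 1) * t - Re z * cosh t)" by auto
      then show ?thesis unfolding norm_exp_cosh by (smt (verit) exp_gt_zero)
    qed
  qed (auto intro!: borel_measurable_continuous_onI continuous_intros tendsto_intros)
  then show ?thesis by (subst (asm) at_within_open) auto
qed

theorem bessel_K_eq_cosh_integral:
  assumes a: "a > 0" and z: "Re z > 0"
  shows "bessel_K a z = cosh_integral a z / 2"
proof (cases "a \<in> \<int>")
  case False
  then show ?thesis using cosh_integral_eq_bessel_I[OF a False z] by (simp add: bessel_K_def)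
next
  case True
  define q where "q = (\<lambda>b. of_real pi / 2 * (bessel_I (- b) z - bessel_I b z) / of_real (sin (b * pi)))"
  \<comment> \<open>Hence the punctured unit ball around \<open>a\<close> contains only positive
    non-integer orders, where the quotient is already known.\<close>
  have "a \<ge> 1" using True a by (auto elim!: Ints_cases)
  have "q b = cosh_integral b z / 2" if "b \<in> ball a 1" "b \<noteq> a" for b
  proof -
    have "b > 0" using that \<open>a \<ge> 1\<close> by (auto simp: dist_real_def)
    moreover have "b \<notin> \<int>"
      using that True by (auto simp: dist_real_def elim!: Ints_cases)
    ultimately show ?thesis using cosh_integral_eq_bessel_I z by (simp add: q_def)
  qed
  then have "\<forall>\<^sub>F b in at a. cosh_integral b z / 2 = q b"
    unfolding eventually_at_topological by (intro exI[of _ "ball a 1"]) auto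
  then have "(q \<longlongrightarrow> cosh_integral a z / 2) (at a)"
    using tendsto_divide[OF cosh_integral_order_tendsto[OF z] tendsto_const] by (rule Lim_transform_eventually[rotated]) simp
  then have "Lim (at a) q = cosh_integral a z / 2" by (rule tendsto_Lim[rotated]) simp
  then show ?thesis using True by (simp add: bessel_K_def q_def)
qed

theorem norm_bessel_K_less:
  assumes a: "a > 0" and z: "Re z > 0"
  shows "norm (bessel_K a z) < (2 / Re z) powr a * Gamma a / 2"
  using norm_cosh_integral_less[OF z a] unfolding bessel_K_eq_cosh_integral[OF a z] by (simp add: norm_divide)

text \<open>Continuity, inherited from the differentiable integral, later yields measurability of
  the kernel.\<close>

lemma continuous_on_bessel_K:
  assumes "a > 0"
  shows "continuous_on {z. Re z > 0} (bessel_K a)"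
proof -
  have "continuous_on {z. Re z > 0} (\<lambda>z. cosh_integral a z / 2)"
    using has_field_derivative_cosh_integral
    by (intro continuous_intros continuous_at_imp_continuous_on) (auto intro: DERIV_isCont)
  then show ?thesis
    using bessel_K_eq_cosh_integral[OF assms] by (subst continuous_on_cong) auto
qed

subsection \<open>Termwise integration\<close>

lemma summable_on_prod_nonneg:
  fixes \<alpha> \<beta> :: "nat \<Rightarrow> real"
  assumes "summable \<alpha>" "summable \<beta>" "\<And>m. \<alpha> m \<ge> 0" "\<And>n. \<beta> n \<ge> 0"
  shows "(\<lambda>(m, n). \<alpha> m * \<beta> n) summable_on UNIV"
proof -
  have "(\<lambda>(m, n). \<alpha> m * \<beta> n) summable_on (UNIV \<times> UNIV)"
  proof (rule summable_on_SigmaI)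
    show "((\<lambda>n. (\<lambda>(m, n). \<alpha> m * \<beta> n) (m, n)) has_sum \<alpha> m * suminf \<beta>) UNIV" for m
      using sums_nonneg_imp_has_sum[OF summable_sums[OF assms(2)] assms(4)]
      by (simp add: has_sum_cmult_right)
    show "(\<lambda>m. \<alpha> m * suminf \<beta>) summable_on UNIV"
      using assms by (intro summable_on_cmult_left) (simp add: summable_on_UNIV_nonneg_real_iff)
  qed (use assms in auto)
  then show ?thesis by simp
qed

text \<open>The functions \<open>\<alpha> m * \<beta> n * norm (w t)\<close> dominate the terms, so
  sum and integral may be exchanged. The bounds are asked only where \<open>w t \<noteq> 0\<close>,
  so that \<open>w\<close> can carry the indicator of the integration range.\<close>

lemma infsum_integral_product_series:
  fixes A B :: "nat \<Rightarrow> 'a \<Rightarrow> complex" and w :: "'a \<Rightarrow> complex"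
  assumes w: "integrable M w"
    and meas: "\<And>m. A m \<in> borel_measurable M" "\<And>n. B n \<in> borel_measurable M"
    and bound: "\<And>m t. w t \<noteq> 0 \<Longrightarrow> norm (A m t) \<le> \<alpha> m" "\<And>n t. w t \<noteq> 0 \<Longrightarrow> norm (B n t) \<le> \<beta> n"
    and summable: "summable \<alpha>" "summable \<beta>"
    and nonneg: "\<And>m. \<alpha> m \<ge> 0" "\<And>n. \<beta> n \<ge> 0"
    and sums: "\<And>t. w t \<noteq> 0 \<Longrightarrow> (\<lambda>m. A m t) sums S t" "\<And>t. w t \<noteq> 0 \<Longrightarrow> (\<lambda>n. B n t) sums T t"
  shows "(\<Sum>\<^sub>\<infinity>(m, n)\<in>UNIV. LINT t|M. A m t * B n t * w t) = (LINT t|M. S t * T t * w t)"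
proof -
  \<comment> \<open>Enumerating the index pairs reduces the double sum to an ordinary
    series.\<close>
  define e where "e = prod_decode"
  have e: "bij_betw e UNIV UNIV" unfolding e_def by (rule bij_prod_decode)
  define f where "f = (\<lambda>p t. A (fst p) t * B (snd p) t * w t)"
  define \<gamma> where "\<gamma> = (\<lambda>p. \<alpha> (fst p) * \<beta> (snd p))"
  have \<gamma>: "\<gamma> summable_on UNIV" "\<gamma> p \<ge> 0" for p
    using summable_on_prod_nonneg[OF summable nonneg] nonneg by (simp_all add: \<gamma>_def case_prod_beta')
  have \<gamma>e: "summable (\<lambda>i. \<gamma> (e i))"
    using \<gamma>(1) summable_on_reindex_bij_betw[OF e, of \<gamma>] \<gamma>(2) by (simp flip: summable_on_UNIV_nonneg_real_iff)
  have le: "norm (f p t) \<le> \<gamma> p * norm (w t)" for p t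
    by (cases "w t = 0") (auto simp: f_def \<gamma>_def norm_mult intro!: mult_mono bound nonneg)
  have int: "integrable M (f p)" for p
  proof (rule Bochner_Integration.integrable_bound)
    show "integrable M (\<lambda>t. \<gamma> p * norm (w t))" using w by simp
    show "f p \<in> borel_measurable M"
      unfolding f_def using meas w by (intro borel_measurable_times) auto
  qed (use le \<gamma> in auto)
  have intn: "(LINT t|M. norm (f p t)) \<le> \<gamma> p * (LINT t|M. norm (w t))" for p
    using integral_mono[of M "\<lambda>t. norm (f p t)" "\<lambda>t. \<gamma> p * norm (w t)"] int[of p] w le by simp
  have pointwise: "(\<Sum>i. f (e i) t) = S t * T t * w t" for t
  proof (cases "w t = 0")
    case True
    then show ?thesis by (simp add: f_def)
  next
    case False
    have nA: "summable (\<lambda>m. norm (A m t))" and nB: "summable (\<lambda>n. norm (B n t))"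
      using summable bound[OF False] by (auto intro: summable_comparison_test')
    have "((\<lambda>p. A (fst p) t * B (snd p) t) has_sum (S t * T t)) (UNIV \<times> UNIV)"
    proof (rule has_sum_SigmaI)
      show "((\<lambda>n. A (fst (m, n)) t * B (snd (m, n)) t) has_sum (A m t * T t)) UNIV" for m
        using norm_summable_imp_has_sum[OF nB sums(2)[OF False]] by (simp add: has_sum_cmult_right)
      show "((\<lambda>m. A m t * T t) has_sum (S t * T t)) UNIV"
        using norm_summable_imp_has_sum[OF nA sums(1)[OF False]] by (rule has_sum_cmult_left)
      show "(\<lambda>p. A (fst p) t * B (snd p) t) summable_on UNIV \<times> UNIV"
      proof (rule abs_summable_summable)
        show "(\<lambda>p. norm (A (fst p) t * B (snd p) t)) summable_on UNIV \<times> UNIV"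
          using summable_on_prod_nonneg[OF nA nB norm_ge_zero norm_ge_zero]
          by (simp only: norm_mult case_prod_beta' UNIV_Times_UNIV)
      qed
    qed
    then have "((\<lambda>i. A (fst (e i)) t * B (snd (e i)) t) has_sum (S t * T t)) UNIV"
      using has_sum_reindex_bij_betw[OF e, of "\<lambda>p. A (fst p) t * B (snd p) t"] by simp
    then have "(\<lambda>i. A (fst (e i)) t * B (snd (e i)) t) sums (S t * T t)"
      by (rule has_sum_imp_sums)
    then show ?thesis
      by (simp add: f_def sums_mult2 sums_unique[symmetric])
  qed
  have sn: "summable (\<lambda>i. LINT t|M. norm (f (e i) t))"
    by (rule summable_comparison_test'[OF summable_mult2[OF \<gamma>e, of "LINT t|M. norm (w t)"]])
       (use intn in \<open>simp add: integral_nonneg_AE\<close>)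
  have "(LINT t|M. S t * T t * w t) = (LINT t|M. (\<Sum>i. f (e i) t))"
    by (simp add: pointwise)
  also have "\<dots> = (\<Sum>i. LINT t|M. f (e i) t)"
  proof (rule integral_suminf[OF int _ sn])
    show "AE t in M. summable (\<lambda>i. norm (f (e i) t))"
      by (intro AE_I2 summable_comparison_test'[OF summable_mult2[OF \<gamma>e]]) (use le in simp)
  qed
  \<comment> \<open>Absolute summability identifies the ordered sum with the unordered one, which is
    independent of the enumeration.\<close>
  also have "\<dots> = (\<Sum>\<^sub>\<infinity>i. LINT t|M. f (e i) t)"
  proof -
    have "summable (\<lambda>i. norm (LINT t|M. f (e i) t))"
      by (rule summable_comparison_test'[OF sn]) simp
    from norm_summable_imp_has_sum[OF this summable_sums[OF summable_norm_cancel[OF this]]]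
    show ?thesis by (simp add: infsumI)
  qed
  also have "\<dots> = (\<Sum>\<^sub>\<infinity>p. LINT t|M. f p t)"
    by (rule infsum_reindex_bij_betw[OF e])
  finally show ?thesis by (simp add: f_def case_prod_beta')
qed

text \<open>Newton's binomial series with exponent \<open>- b\<close> at \<open>- z\<close>; the two
  signs of the \<open>n\<close>-th term cancel.\<close>

lemma powr_minus_sums:
  fixes b z :: complex
  assumes z: "norm z < 1"
  shows "(\<lambda>n. pochhammer b n * (z ^ n / fact n)) sums (1 - z) powr (- b)"
proof -
  have "(- b gchoose n) * (- z) ^ n = pochhammer b n * (z ^ n / fact n)" for n
    by (simp add: gbinomial_pochhammer power_minus[of z])
  with gen_binomial_complex[of "- z" "- b"] z show ?thesis by simp
qed

text \<open>Convergence at a real \<open>r\<close> strictly between \<open>norm z\<close> and 1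
  gives absolute convergence at \<open>z\<close>.\<close>

lemma summable_norm_pochhammer:
  fixes b z :: complex
  assumes z: "norm z < 1"
  shows "summable (\<lambda>n. norm (pochhammer b n * (z ^ n / fact n)))"
proof -
  obtain r where r: "norm z < r" "r < 1" using dense[OF z] by auto
  then have "norm (of_real r :: complex) < 1" using norm_ge_zero[of z] by (simp del: norm_ge_zero)
  from sums_summable[OF powr_minus_sums[OF this, of b]]
  have "summable (\<lambda>n. (pochhammer b n / fact n) * of_real r ^ n)" by simp
  from powser_insidea[OF this, of z] r have "summable (\<lambda>n. norm (pochhammer b n / fact n * z ^ n))"
    by (smt (verit) norm_of_real norm_ge_zero)
  then show ?thesis by simp
qed

subsection \<open>The Euler integral of the extended Appell function\<close>

text \<open>For real parameters the powers are taken as real ones, so that only the Bessel factor is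
  complex.\<close>

definition ext_beta_kernel :: "complex \<Rightarrow> real \<Rightarrow> real \<Rightarrow> real \<Rightarrow> real \<Rightarrow> complex" where
  "ext_beta_kernel p \<nu> u v t =
     of_real (t powr (u - 3/2) * (1 - t) powr (v - 3/2)) * bessel_K (\<nu> + 1/2) (p / of_real (t * (1 - t)))"

lemma ext_beta_kernel_alt:
  assumes "t \<in> {0<..<1}"
  shows "of_real t powr (of_real u - 3/2) * of_real (1 - t) powr (of_real v - 3/2) *
      bessel_K (\<nu> + 1/2) (p / of_real (t * (1 - t))) = ext_beta_kernel p \<nu> u v t"
proof -
  have "complex_of_real s powr (of_real r - 3/2) = of_real (s powr (r - 3/2))" if "s > 0" for r s
    using powr_of_real[of s "r - 3/2"] that by simp
  from this[of t u] this[of "1 - t" v] assms show ?thesis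
    by (simp add: ext_beta_kernel_def)
qed

text \<open>At the argument \<open>p / (t (1 - t))\<close> the Bessel bound contributes
  \<open>(t (1 - t)) powr (\<nu> + 1/2)\<close>. This raises the exponents \<open>u - 3/2\<close>
  and \<open>v - 3/2\<close> to those of a Beta integrand with both parameters shifted by
  \<open>\<nu>\<close>.\<close>

lemma norm_ext_beta_kernel_less:
  assumes p: "Re p > 0" and \<nu>: "\<nu> \<ge> 0" and t: "t \<in> {0<..<1}"
  shows "norm (ext_beta_kernel p \<nu> u v t) <
      (2 / Re p) powr (\<nu> + 1/2) * Gamma (\<nu> + 1/2) / 2 * (t powr (u + \<nu> - 1) * (1 - t) powr (v + \<nu> - 1))"
proof -
  have s: "t * (1 - t) > 0" using t by simp
  define P where "P = t powr (u - 3/2) * (1 - t) powr (v - 3/2)"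
  have P: "P > 0" using t by (simp add: P_def)
  have Re: "Re (p / of_real (t * (1 - t))) = Re p / (t * (1 - t))"
    by (simp only: Re_divide_of_real)
  have "norm (bessel_K (\<nu> + 1/2) (p / of_real (t * (1 - t)))) <
      (2 / (Re p / (t * (1 - t)))) powr (\<nu> + 1/2) * Gamma (\<nu> + 1/2) / 2"
    using norm_bessel_K_less[of "\<nu> + 1/2" "p / of_real (t * (1 - t))"] p \<nu> s unfolding Re by simp
  also have "(2 / (Re p / (t * (1 - t)))) powr (\<nu> + 1/2) =
      (2 / Re p) powr (\<nu> + 1/2) * (t powr (\<nu> + 1/2) * (1 - t) powr (\<nu> + 1/2))"
    using p t by (simp add: powr_mult powr_divide)
  finally have "P * norm (bessel_K (\<nu> + 1/2) (p / of_real (t * (1 - t)))) <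
      P * ((2 / Re p) powr (\<nu> + 1/2) * (t powr (\<nu> + 1/2) * (1 - t) powr (\<nu> + 1/2)) * Gamma (\<nu> + 1/2) / 2)"
    using P by (intro mult_strict_left_mono)
  also have "\<dots> = (2 / Re p) powr (\<nu> + 1/2) * Gamma (\<nu> + 1/2) / 2 *
      ((t powr (u - 3/2) * t powr (\<nu> + 1/2)) * ((1 - t) powr (v - 3/2) * (1 - t) powr (\<nu> + 1/2)))"
    by (simp add: P_def)
  also have "\<dots> = (2 / Re p) powr (\<nu> + 1/2) * Gamma (\<nu> + 1/2) / 2 * (t powr (u + \<nu> - 1) * (1 - t) powr (v + \<nu> - 1))"
    by (simp add: algebra_simps flip: powr_add)
  finally show ?thesis
    using P by (simp add: ext_beta_kernel_def norm_mult P_def)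
qed

lemma continuous_on_ext_beta_kernel:
  assumes p: "Re p > 0" and \<nu>: "\<nu> \<ge> 0"
  shows "continuous_on {0<..<1} (ext_beta_kernel p \<nu> u v)"
  unfolding ext_beta_kernel_def
proof (intro continuous_intros)
  show "continuous_on {0<..<1} (\<lambda>t. bessel_K (\<nu> + 1/2) (p / of_real (t * (1 - t))))"
  proof (rule continuous_on_compose2[OF continuous_on_bessel_K])
    show "(\<lambda>t. p / of_real (t * (1 - t))) ` {0<..<1} \<subseteq> {z. 0 < Re z}"
      using p by (auto simp: Re_divide_of_real simp del: of_real_mult)
  qed (use \<nu> in \<open>auto intro!: continuous_intros\<close>)
qed auto

text \<open>A weight continuous on the closed interval is bounded, so the shifted Beta integrand
  dominates; the kernel bound transfers this to the second claim.\<close>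

lemma set_integrable_continuous_mult_ext_beta_kernel:
  assumes p: "Re p > 0" and \<nu>: "\<nu> \<ge> 0" and uv: "u > 0" "v > 0"
    and \<phi>: "continuous_on {0..1} (\<phi> :: real \<Rightarrow> real)"
  shows "set_integrable lborel {0<..<1} (\<lambda>t. \<phi> t * (t powr (u + \<nu> - 1) * (1 - t) powr (v + \<nu> - 1)))"
    and "set_integrable lborel {0<..<1} (\<lambda>t. of_real (\<phi> t) * ext_beta_kernel p \<nu> u v t)"
proof -
  have \<phi>': "continuous_on {0<..<1} \<phi>" using \<phi> by (rule continuous_on_subset) auto
  have "compact (\<phi> ` {0..1})" using \<phi> by (intro compact_continuous_image) auto
  then obtain C where C: "\<And>t. t \<in> {0..1} \<Longrightarrow> \<bar>\<phi> t\<bar> \<le> C"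
    using compact_imp_bounded[of "\<phi> ` {0..1}"] unfolding bounded_iff by fastforce
  define k where "k = (\<lambda>t. t powr (u + \<nu> - 1) * (1 - t) powr (v + \<nu> - 1))"
  have k: "set_integrable lborel {0<..<1} k"
    unfolding k_def using uv \<nu> by (intro set_integrable_subset[OF integrable_Beta[of "u + \<nu>" "v + \<nu>"]]) auto
  have k0: "k t \<ge> 0" for t by (simp add: k_def)
  show *: "set_integrable lborel {0<..<1} (\<lambda>t. \<phi> t * (t powr (u + \<nu> - 1) * (1 - t) powr (v + \<nu> - 1)))"
  proof (rule set_integrable_bound)
    show "set_integrable lborel {0<..<1} (\<lambda>t. C * k t)" using k by simp
    show "set_borel_measurable lborel {0<..<1} (\<lambda>t. \<phi> t * (t powr (u + \<nu> - 1) * (1 - t) powr (v + \<nu> - 1)))"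
    proof -
      have "continuous_on {0<..<1} (\<lambda>t. \<phi> t * (t powr (u + \<nu> - 1) * (1 - t) powr (v + \<nu> - 1)))"
        by (intro continuous_intros \<phi>') auto
      from borel_measurable_continuous_on_indicator[OF _ this] show ?thesis
        by (simp add: set_borel_measurable_def)
    qed
    have "norm (\<phi> t * k t) \<le> norm (C * k t)" if "t \<in> {0<..<1}" for t
    proof -
      have "\<bar>\<phi> t\<bar> \<le> \<bar>C\<bar>" using C[of t] that by simp
      with k0[of t] show ?thesis by (simp add: abs_mult mult_right_mono)
    qed
    then show "AE t in lborel. t \<in> {0<..<1} \<longrightarrow>
        norm (\<phi> t * (t powr (u + \<nu> - 1) * (1 - t) powr (v + \<nu> - 1))) \<le> norm (C * k t)"
      unfolding k_def by auto
  qed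
  show "set_integrable lborel {0<..<1} (\<lambda>t. of_real (\<phi> t) * ext_beta_kernel p \<nu> u v t)"
  proof (rule set_integrable_bound)
    define D where "D = (2 / Re p) powr (\<nu> + 1/2) * Gamma (\<nu> + 1/2) / 2"
    show "set_integrable lborel {0<..<1} (\<lambda>t. D * (\<phi> t * k t))" using * by (simp add: k_def)
    show "set_borel_measurable lborel {0<..<1} (\<lambda>t. of_real (\<phi> t) * ext_beta_kernel p \<nu> u v t)"
    proof -
      have "continuous_on {0<..<1} (\<lambda>t. of_real (\<phi> t) * ext_beta_kernel p \<nu> u v t)"
        by (intro continuous_intros \<phi>' continuous_on_ext_beta_kernel[OF p \<nu>])
      from borel_measurable_continuous_on_indicator[OF _ this] show ?thesis
        by (simp add: set_borel_measurable_def)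
    qed
    have "norm (of_real (\<phi> t) * ext_beta_kernel p \<nu> u v t) \<le> norm (D * (\<phi> t * k t))" if "t \<in> {0<..<1}" for t
    proof -
      have "norm (ext_beta_kernel p \<nu> u v t) \<le> D * k t"
        using norm_ext_beta_kernel_less[OF p \<nu> that, of u v] by (simp add: D_def k_def)
      also have "\<dots> \<le> \<bar>D * k t\<bar>" by simp
      finally have "\<bar>\<phi> t\<bar> * norm (ext_beta_kernel p \<nu> u v t) \<le> \<bar>\<phi> t\<bar> * \<bar>D * k t\<bar>"
        by (intro mult_left_mono) auto
      then show ?thesis by (simp add: norm_mult abs_mult mult_ac)
    qed
    then show "AE t in lborel. t \<in> {0<..<1} \<longrightarrow>
        norm (of_real (\<phi> t) * ext_beta_kernel p \<nu> u v t) \<le> norm (D * (\<phi> t * k t))" by auto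
  qed
qed

section \<open>The algebraic weight and the equality of series and integral\<close>

definition appell_weight :: "real \<Rightarrow> real \<Rightarrow> real \<Rightarrow> real \<Rightarrow> real \<Rightarrow> real" where
  "appell_weight b2 b3 x y t = (1 - x * t) powr (- b2) * (1 - y * t) powr (- b3)"

lemma one_minus_mult_pos:
  assumes "(x::real) < 1" "t \<in> {0..1}"
  shows "1 - x * t > 0"
proof (cases "x \<le> 0")
  case True
  then show ?thesis using assms mult_nonpos_nonneg[of x t] by simp
next
  case False
  then have "x * t \<le> x * 1" using assms by (intro mult_left_mono) auto
  with assms show ?thesis by simp
qed

lemma appell_weight_pos:
  assumes "x < 1" "y < 1" "t \<in> {0..1}"
  shows "appell_weight b2 b3 x y t > 0"
  using one_minus_mult_pos[OF assms(1,3)] one_minus_mult_pos[OF assms(2,3)]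
  by (simp add: appell_weight_def)

lemma continuous_on_appell_weight:
  assumes "x < 1" "y < 1"
  shows "continuous_on {0..1} (appell_weight b2 b3 x y)"
  unfolding appell_weight_def
  using one_minus_mult_pos[OF assms(1)] one_minus_mult_pos[OF assms(2)]
  by (intro continuous_intros) force+

text \<open>For \<open>x, y < 1\<close> all bases are positive reals on the open interval, where
  principal complex powers agree with real powers.\<close>

lemma ext_appell_F1_integral_eq:
  assumes xy: "x < 1" "y < 1" and b: "b1 > 0" "c1 > b1"
  shows "ext_appell_F1_integral p \<nu> (of_real b1) (of_real b2) (of_real b3) (of_real c1) (of_real x) (of_real y) =
    of_real (1 / Beta b1 (c1 - b1)) * csqrt (2 * p / of_real pi) *
    (LINT t:{0<..<1}|lborel. of_real (appell_weight b2 b3 x y t) * ext_beta_kernel p \<nu> b1 (c1 - b1) t)"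
proof -
  have "Gamma (of_real c1) / (Gamma (of_real b1) * Gamma (of_real c1 - of_real b1)) =
      complex_of_real (1 / Beta b1 (c1 - b1))"
    by (simp add: Beta_def Gamma_complex_of_real flip: of_real_diff of_real_add)
  moreover have "(LINT t:{0<..<1}|lborel.
        of_real t powr (of_real b1 - 3 / 2) * of_real (1 - t) powr (of_real c1 - of_real b1 - 3 / 2) *
        (1 - of_real x * of_real t) powr (- of_real b2) * (1 - of_real y * of_real t) powr (- of_real b3) *
        bessel_K (\<nu> + 1 / 2) (p / of_real (t * (1 - t)))) =
      (LINT t:{0<..<1}|lborel. of_real (appell_weight b2 b3 x y t) * ext_beta_kernel p \<nu> b1 (c1 - b1) t)"
  proof (rule set_lebesgue_integral_cong)
    have "of_real t powr (of_real b1 - 3 / 2) * of_real (1 - t) powr (of_real c1 - of_real b1 - 3 / 2) *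
        (1 - of_real x * of_real t) powr (- of_real b2) * (1 - of_real y * of_real t) powr (- of_real b3) *
        bessel_K (\<nu> + 1 / 2) (p / of_real (t * (1 - t))) =
        of_real (appell_weight b2 b3 x y t) * ext_beta_kernel p \<nu> b1 (c1 - b1) t"
      if t: "t \<in> {0<..<1}" for t
    proof -
      have *: "(1 - of_real s * of_real t) powr (- of_real b) = complex_of_real ((1 - s * t) powr (- b))"
        if "s < 1" for s b
        using one_minus_mult_pos[OF that, of t] t powr_of_real[of "1 - s * t" "- b"] by simp
      show ?thesis
        unfolding ext_beta_kernel_alt[OF t, symmetric] appell_weight_def *[OF xy(1)] *[OF xy(2)]
        by (simp add: mult_ac)
    qed
    then show "\<forall>t. t \<in> {0<..<1} \<longrightarrow> of_real t powr (of_real b1 - 3 / 2) * of_real (1 - t) powr (of_real c1 - of_real b1 - 3 / 2) *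
        (1 - of_real x * of_real t) powr (- of_real b2) * (1 - of_real y * of_real t) powr (- of_real b3) *
        bessel_K (\<nu> + 1 / 2) (p / of_real (t * (1 - t))) =
        of_real (appell_weight b2 b3 x y t) * ext_beta_kernel p \<nu> b1 (c1 - b1) t" by blast
  qed auto
  ultimately show ?thesis unfolding ext_appell_F1_integral_def by (simp only:)
qed

text \<open>Both factors of the weight are expanded in binomial series and integrated termwise;
  \<open>t ^ m * t ^ n\<close> raises the first parameter of the kernel to
  \<open>b1 + m + n\<close>.\<close>

theorem ext_appell_F1_series_eq_integral:
  assumes xy: "\<bar>x\<bar> < 1" "\<bar>y\<bar> < 1" and b: "b1 > 0" "c1 > b1" and \<nu>: "\<nu> \<ge> 0" and p: "Re p > 0"
  shows "ext_appell_F1_series p \<nu> (of_real b1) (of_real b2) (of_real b3) (of_real c1) (of_real x) (of_real y) =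
    ext_appell_F1_integral p \<nu> (of_real b1) (of_real b2) (of_real b3) (of_real c1) (of_real x) (of_real y)"
proof -
  define K where "K = (\<lambda>t. indicator {0<..<1} t *\<^sub>R ext_beta_kernel p \<nu> b1 (c1 - b1) t)"
  define c where "c = complex_of_real (1 / Beta b1 (c1 - b1)) * csqrt (2 * p / of_real pi)"
  define A where "A = (\<lambda>b z m t. pochhammer (of_real b) m * ((of_real (z * t)) ^ m / fact m) :: complex)"
  \<comment> \<open>The norm of the binomial term at \<open>t = 1\<close>, a bound uniform in
    \<open>t\<close> because \<open>|z * t| \<le> |z|\<close>.\<close>
  define \<alpha> where "\<alpha> = (\<lambda>b z m. norm (pochhammer (of_real b) m * ((of_real z) ^ m / fact m) :: complex))"
  have zt: "\<bar>z * t\<bar> \<le> \<bar>z\<bar>" "t \<in> {0<..<1}" if "K t \<noteq> 0" for z t :: real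
    using that by (auto simp: K_def indicator_def abs_mult mult_left_le split: if_splits)
  have A: "A b z m \<in> borel_measurable lborel" for b z m
    unfolding A_def by (auto intro!: borel_measurable_continuous_onI continuous_intros)
  have bound: "norm (A b z m t) \<le> \<alpha> b z m" if "K t \<noteq> 0" for b z m t
    unfolding A_def \<alpha>_def norm_mult norm_divide norm_power norm_of_real
    using zt(1)[OF that] by (intro mult_left_mono divide_right_mono power_mono) auto
  have sums: "(\<lambda>m. A b z m t) sums of_real ((1 - z * t) powr (- b))" if "\<bar>z\<bar> < 1" "K t \<noteq> 0" for b z t
  proof -
    have lt: "\<bar>z * t\<bar> < 1" using zt(1)[OF that(2), of z] that(1) by simp
    then have "(1 - of_real (z * t)) powr (- of_real b) = complex_of_real ((1 - z * t) powr (- b))"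
      using powr_of_real[of "1 - z * t" "- b"] by simp
    with powr_minus_sums[of "of_real (z * t)" "of_real b"] lt show ?thesis
      unfolding A_def norm_of_real by simp
  qed
  have "(\<Sum>\<^sub>\<infinity>(m, n)\<in>UNIV. LINT t|lborel. A b2 x m t * A b3 y n t * K t) =
      (LINT t|lborel. of_real ((1 - x * t) powr (- b2)) * of_real ((1 - y * t) powr (- b3)) * K t)"
  proof (rule infsum_integral_product_series[OF _ A A bound bound])
    show "integrable lborel K"
      using set_integrable_continuous_mult_ext_beta_kernel(2)[OF p \<nu> b(1), of "c1 - b1" "\<lambda>_. 1"] b
      by (simp add: set_integrable_def K_def)
    show "summable (\<alpha> b2 x)" "summable (\<alpha> b3 y)"
      unfolding \<alpha>_def using xy by (auto intro!: summable_norm_pochhammer simp del: times_divide_eq_right)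
  qed (use xy in \<open>auto simp: \<alpha>_def intro!: sums\<close>)
  also have "\<dots> = (LINT t:{0<..<1}|lborel. of_real (appell_weight b2 b3 x y t) * ext_beta_kernel p \<nu> b1 (c1 - b1) t)"
    by (simp add: set_lebesgue_integral_def K_def appell_weight_def)
  finally have sum: "(\<Sum>\<^sub>\<infinity>(m, n)\<in>UNIV. LINT t|lborel. A b2 x m t * A b3 y n t * K t) = \<dots>" .
  have term_eq: "pochhammer (of_real b2) m * pochhammer (of_real b3) n *
        ext_Beta p \<nu> (of_real b1 + of_nat m + of_nat n) (of_real c1 - of_real b1) / Beta (of_real b1) (of_real c1 - of_real b1) *
        (of_real x ^ m / fact m) * (of_real y ^ n / fact n) =
      c * (LINT t|lborel. A b2 x m t * A b3 y n t * K t)" for m n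
  proof -
    define k where "k = (\<lambda>t. ext_beta_kernel p \<nu> (b1 + real m + real n) (c1 - b1) t)"
    have k: "k t = of_real t ^ m * of_real t ^ n * ext_beta_kernel p \<nu> b1 (c1 - b1) t" if t: "t \<in> {0<..<1}" for t
    proof -
      have "t powr (b1 + real m + real n - 3/2) = t powr (b1 - 3/2) * t ^ m * t ^ n"
        using t by (simp add: powr_add powr_diff powr_realpow)
      then show ?thesis by (simp add: k_def ext_beta_kernel_def)
    qed
    have "ext_Beta p \<nu> (of_real b1 + of_nat m + of_nat n) (of_real c1 - of_real b1) =
        csqrt (2 * p / of_real pi) * (LINT t:{0<..<1}|lborel. k t)"
    proof -
      have "(LINT t:{0<..<1}|lborel.
          of_real t powr (of_real b1 + of_nat m + of_nat n - 3/2) * of_real (1 - t) powr (of_real c1 - of_real b1 - 3/2) *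
          bessel_K (\<nu> + 1/2) (p / of_real (t * (1 - t)))) = (LINT t:{0<..<1}|lborel. k t)"
        using ext_beta_kernel_alt[of _ "b1 + real m + real n" "c1 - b1" \<nu> p]
        by (intro set_lebesgue_integral_cong) (auto simp: k_def)
      then show ?thesis by (simp add: ext_Beta_def)
    qed
    moreover have "Beta (of_real b1) (of_real c1 - of_real b1) = complex_of_real (Beta b1 (c1 - b1))"
      by (simp add: Beta_def Gamma_complex_of_real flip: of_real_diff of_real_add)
    moreover have "(LINT t|lborel. A b2 x m t * A b3 y n t * K t) =
        pochhammer (of_real b2) m * pochhammer (of_real b3) n * (of_real x ^ m / fact m) * (of_real y ^ n / fact n) *
        (LINT t:{0<..<1}|lborel. k t)"
    proof -
      have "A b2 x m t * A b3 y n t * K t =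
          pochhammer (of_real b2) m * pochhammer (of_real b3) n * (of_real x ^ m / fact m) * (of_real y ^ n / fact n) *
          (indicator {0<..<1} t *\<^sub>R k t)" for t
        by (cases "t \<in> {0<..<1}") (simp_all add: K_def A_def k power_mult_distrib)
      then show ?thesis unfolding set_lebesgue_integral_def by (simp only: integral_mult_right_zero)
    qed
    ultimately show ?thesis by (simp add: c_def mult_ac)
  qed
  have "ext_appell_F1_series p \<nu> (of_real b1) (of_real b2) (of_real b3) (of_real c1) (of_real x) (of_real y) =
      (\<Sum>\<^sub>\<infinity>(m, n)\<in>UNIV. c * (LINT t|lborel. A b2 x m t * A b3 y n t * K t))"
    unfolding ext_appell_F1_series_def term_eq ..
  also have "\<dots> = c * (\<Sum>\<^sub>\<infinity>(m, n)\<in>UNIV. LINT t|lborel. A b2 x m t * A b3 y n t * K t)"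
    by (simp add: case_prod_beta' infsum_cmult_right')
  finally show ?thesis
    using xy b unfolding sum by (subst ext_appell_F1_integral_eq) (auto simp: c_def)
qed

section \<open>The strict estimate of the Euler integral\<close>

lemma appell_F1_real:
  "appell_F1 a b2 b3 c x y = 1 / Beta a (c - a) *
     (LINT t:{0<..<1}|lborel. appell_weight b2 b3 x y t * (t powr (a - 1) * (1 - t) powr (c - a - 1)))"
  for a b2 b3 c x y :: real
  by (simp add: appell_F1_def Beta_def appell_weight_def mult_ac)

lemma norm_ext_appell_F1_integral_less:
  assumes b: "b1 > 0" "c1 > b1" and xy: "x < 1" "y < 1" and \<nu>: "\<nu> \<ge> 0" and p: "Re p > 0"
  shows "norm (ext_appell_F1_integral p \<nu> (of_real b1) (of_real b2) (of_real b3) (of_real c1) (of_real x) (of_real y))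
       < 2 powr \<nu> * norm p powr (\<nu> + 1) / (sqrt pi * Re p powr (2 * \<nu> + 1))
         * (Gamma (\<nu> + 1 / 2) * Beta (b1 + \<nu>) (c1 - b1 + \<nu>) / Beta b1 (c1 - b1))
         * appell_F1 (b1 + \<nu>) b2 b3 (c1 + 2 * \<nu>) x y"
proof -
  define \<phi> where "\<phi> = appell_weight b2 b3 x y"
  define d where "d = c1 - b1"
  have d: "d > 0" using b by (simp add: d_def)
  define k where "k = (\<lambda>t. t powr (b1 + \<nu> - 1) * (1 - t) powr (d + \<nu> - 1))"
  define D where "D = (2 / Re p) powr (\<nu> + 1/2) * Gamma (\<nu> + 1/2) / 2"
  have G: "Gamma (\<nu> + 1/2) > 0" using \<nu> by (intro Gamma_real_pos) auto
  have B: "Beta b1 d > 0" "Beta (b1 + \<nu>) (d + \<nu>) > 0"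
    using b d \<nu> by (auto simp: Beta_def intro!: divide_pos_pos mult_pos_pos Gamma_real_pos)
  have \<phi>: "continuous_on {0..1} \<phi>" unfolding \<phi>_def using xy by (rule continuous_on_appell_weight)
  have \<phi>_pos: "\<phi> t > 0" if "t \<in> {0<..<1}" for t
    unfolding \<phi>_def using xy that by (intro appell_weight_pos) auto
  note int = set_integrable_continuous_mult_ext_beta_kernel[OF p \<nu> b(1) d \<phi>]
  have "norm (LINT t:{0<..<1}|lborel. of_real (\<phi> t) * ext_beta_kernel p \<nu> b1 d t) \<le>
      (LINT t:{0<..<1}|lborel. norm (of_real (\<phi> t) * ext_beta_kernel p \<nu> b1 d t))"
    using int(2) by (rule set_integral_norm_bound)
  also have "\<dots> < (LINT t:{0<..<1}|lborel. D * (\<phi> t * k t))"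
    unfolding set_lebesgue_integral_def
  proof (rule integral_strict_mono[where A = "{0<..<1}"])
    have less: "norm (of_real (\<phi> t) * ext_beta_kernel p \<nu> b1 d t) < D * (\<phi> t * k t)" if "t \<in> {0<..<1}" for t
      using norm_ext_beta_kernel_less[OF p \<nu> that, of b1 d] \<phi>_pos[OF that]
      by (simp add: norm_mult D_def k_def)
    then show "indicator {0<..<1} t *\<^sub>R norm (of_real (\<phi> t) * ext_beta_kernel p \<nu> b1 d t) <
        indicator {0<..<1} t *\<^sub>R (D * (\<phi> t * k t))" if "t \<in> {0<..<1}" for t
      using that by simp
    show "indicator {0<..<1} t *\<^sub>R norm (of_real (\<phi> t) * ext_beta_kernel p \<nu> b1 d t) \<le>
        indicator {0<..<1} t *\<^sub>R (D * (\<phi> t * k t))" for t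
      using less_imp_le[OF less[of t]] by (cases "t \<in> {0<..<1}") (simp_all add: indicator_def)
    show "integrable lborel (\<lambda>t. indicator {0<..<1} t *\<^sub>R norm (of_real (\<phi> t) * ext_beta_kernel p \<nu> b1 d t))"
      using set_integrable_norm[OF int(2)] by (simp add: set_integrable_def)
    show "integrable lborel (\<lambda>t. indicator {0<..<1} t *\<^sub>R (D * (\<phi> t * k t)))"
      using set_integrable_mult_right[of D, OF int(1)] by (simp add: set_integrable_def k_def)
  qed auto
  also have "\<dots> = D * (LINT t:{0<..<1}|lborel. \<phi> t * k t)" by simp
  finally have main: "norm (LINT t:{0<..<1}|lborel. of_real (\<phi> t) * ext_beta_kernel p \<nu> b1 d t) <
      D * (LINT t:{0<..<1}|lborel. \<phi> t * k t)" .
  define I where "I = (LINT t:{0<..<1}|lborel. \<phi> t * k t)"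
  have I: "I \<ge> 0"
    unfolding I_def set_lebesgue_integral_def
    using \<phi>_pos by (intro Bochner_Integration.integral_nonneg) (auto simp: indicator_def k_def less_imp_le)
  \<comment> \<open>Since \<open>c1 + 2 * \<nu> - (b1 + \<nu>) = d + \<nu>\<close>, the normalising
    Beta value cancels the one in the claimed bound.\<close>
  have F1: "appell_F1 (b1 + \<nu>) b2 b3 (c1 + 2 * \<nu>) x y = I / Beta (b1 + \<nu>) (d + \<nu>)"
    unfolding appell_F1_real I_def \<phi>_def k_def d_def by (simp add: algebra_simps)
  have p0: "p \<noteq> 0" "norm p > 0" using p by auto
  \<comment> \<open>The direct estimate gives the sharper
    \<open>norm p powr (1/2) / Re p powr (\<nu> + 1/2)\<close>; multiplying by
    \<open>(norm p / Re p) powr (\<nu> + 1/2)\<close>, which is at least 1, produces the stated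
    powers.\<close>
  have const: "sqrt (2 * norm p / pi) * D \<le>
      2 powr \<nu> * norm p powr (\<nu> + 1) / (sqrt pi * Re p powr (2 * \<nu> + 1)) * Gamma (\<nu> + 1/2)"
  proof -
    have "Re p powr (\<nu> + 1/2) \<le> norm p powr (\<nu> + 1/2)"
      using p \<nu> by (intro powr_mono2) (auto simp: complex_Re_le_cmod)
    then have "1 \<le> norm p powr (\<nu> + 1/2) / Re p powr (\<nu> + 1/2)" using p by simp
    moreover have "sqrt (2 * norm p / pi) * D =
        2 powr \<nu> * norm p powr (1/2) / (sqrt pi * Re p powr (\<nu> + 1/2)) * Gamma (\<nu> + 1/2)"
    proof -
      have sqrt2: "sqrt 2 * (sqrt 2 * r) = 2 * r" for r by (simp flip: mult.assoc)
      show ?thesis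
        using p p0 by (simp add: sqrt2 D_def real_sqrt_mult real_sqrt_divide powr_divide powr_add powr_half_sqrt mult_ac)
    qed
    moreover have "2 powr \<nu> * norm p powr (\<nu> + 1) / (sqrt pi * Re p powr (2 * \<nu> + 1)) * Gamma (\<nu> + 1/2) =
        (2 powr \<nu> * norm p powr (1/2) / (sqrt pi * Re p powr (\<nu> + 1/2)) * Gamma (\<nu> + 1/2)) *
        (norm p powr (\<nu> + 1/2) / Re p powr (\<nu> + 1/2))"
    proof -
      have "norm p powr (\<nu> + 1) = norm p powr (1/2) * norm p powr (\<nu> + 1/2)"
        "Re p powr (2 * \<nu> + 1) = Re p powr (\<nu> + 1/2) * Re p powr (\<nu> + 1/2)"
        by (simp_all add: add.commute flip: powr_add)
      then show ?thesis by (simp add: mult_ac)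
    qed
    moreover have "2 powr \<nu> * norm p powr (1/2) / (sqrt pi * Re p powr (\<nu> + 1/2)) * Gamma (\<nu> + 1/2) \<ge> 0"
      using G by simp
    ultimately show ?thesis by (metis mult.right_neutral mult_left_mono)
  qed
  have "norm (csqrt (2 * p / of_real pi)) = sqrt (2 * norm p / pi)"
    by (simp add: norm_divide norm_mult)
  then have "norm (ext_appell_F1_integral p \<nu> (of_real b1) (of_real b2) (of_real b3) (of_real c1) (of_real x) (of_real y)) =
      (1 / Beta b1 d * sqrt (2 * norm p / pi)) *
        norm (LINT t:{0<..<1}|lborel. of_real (\<phi> t) * ext_beta_kernel p \<nu> b1 d t)"
    unfolding ext_appell_F1_integral_eq[OF xy b] norm_mult
    using B by (simp add: \<phi>_def d_def norm_divide)
  \<comment> \<open>Strictness enters here through \<open>main\<close>, whose prefactor is positive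
    since \<open>p \<noteq> 0\<close>; the enlargement of the constant below is only
    \<open>\<le>\<close>.\<close>
  also have "\<dots> < (1 / Beta b1 d * sqrt (2 * norm p / pi)) * (D * I)"
    using main B p0 unfolding I_def by (intro mult_strict_left_mono) auto
  also have "\<dots> = (sqrt (2 * norm p / pi) * D) * (I / Beta b1 d)"
    by simp
  also have "\<dots> \<le> (2 powr \<nu> * norm p powr (\<nu> + 1) / (sqrt pi * Re p powr (2 * \<nu> + 1)) * Gamma (\<nu> + 1/2)) *
      (I / Beta b1 d)"
    using const I B by (intro mult_right_mono) auto
  also have "\<dots> = 2 powr \<nu> * norm p powr (\<nu> + 1) / (sqrt pi * Re p powr (2 * \<nu> + 1))
         * (Gamma (\<nu> + 1 / 2) * Beta (b1 + \<nu>) (c1 - b1 + \<nu>) / Beta b1 (c1 - b1))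
         * appell_F1 (b1 + \<nu>) b2 b3 (c1 + 2 * \<nu>) x y"
    unfolding F1 d_def[symmetric] using B(2) by simp
  finally show ?thesis .
qed

theorem theorem5:
  fixes b1 b2 b3 c1 x y \<nu> :: real and p :: complex
  assumes "b1 > 0" and "c1 > b1"
    and "x < 1" and "y < 1"
    and "\<nu> \<ge> 0"
    and "Re p > 0"
  shows "norm (ext_appell_F1 p \<nu> (of_real b1) (of_real b2) (of_real b3) (of_real c1)
                 (of_real x) (of_real y))
       < 2 powr \<nu> * norm p powr (\<nu> + 1) / (sqrt pi * Re p powr (2 * \<nu> + 1))
         * (Gamma (\<nu> + 1 / 2) * Beta (b1 + \<nu>) (c1 - b1 + \<nu>) / Beta b1 (c1 - b1))
         * appell_F1 (b1 + \<nu>) b2 b3 (c1 + 2 * \<nu>) x y"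
  \<comment> \<open>For \<open>|x|, |y| < 1\<close> the series equals the integral; otherwise the
    integral is the definition, so one estimate covers both cases.\<close>
  using norm_ext_appell_F1_integral_less[OF assms, of b2 b3] assms
  by (simp add: ext_appell_F1_def ext_appell_F1_series_eq_integral)

end
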